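(* There is no unital associative real algebra $A$ of dimension $3$ for which there exist $a_0,a_1,a_2\in A$ such that the class of $A$-valued functions defined by the single Cauchy condition $$a_0\frac{\partial f}{\partial x_0}+a_1\frac{\partial f}{\partial x_1}+a_2\frac{\partial f}{\partial x_2}=0$$ admits a Cauchy formula. For commutative algebras the result remains true without associativity: there is no commutative, not necessarily associative, unital real algebra $A$ of dimension $3$ with elements $a_0,a_1,a_2$ for which this class admits a Cauchy formula.
   Context: $A$ is identified with $\mathbb{R}^3$ through the coordinates $(x_0,x_1,x_2)$ in a basis $(e_0,e_1,e_2)$ of $A$ with $e_0$ the unit; $\|\cdot\|$ is the Euclidean norm in these coordinates; $A$-valued functions are differentiated and integrated componentwise; $\widehat{dy_j}$ is $dy_0\wedge dy_1\wedge dy_2$ with $dy_j$ omitted. The class of functions is said to admit a Cauchy formula if there exist $b_0,b_1,b_2\in A$ such that, setting $\varphi(x,y)=\sum_{i=0}^2 b_i(y_i-x_i)$, for every bounded domain $D\subset A$ with smooth boundary, every $C^1$ function $f:\overline D\to A$ satisfying the Cauchy condition on $D$, and every $x\in D$, $$f(x)=\int_{\partial D} f(y)\,\Big(\sum_{j=0}^2 a_j\,\frac{\varphi(x,y)}{\|y-x\|^{3}}\,(-1)^j\,\widehat{dy_j}\Big),$$ where $\partial D$ carries the boundary orientation. *)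

theory Defs
  imports "HOL-Analysis.Analysis"
begin

section \<open>Algebras in coordinates\<close>

definition unital_algebra :: "('a::real_vector \<Rightarrow> 'a \<Rightarrow> 'a) \<Rightarrow> 'a \<Rightarrow> bool" where
  "unital_algebra mul one \<longleftrightarrow>
     bilinear mul \<and> (\<forall>x. mul one x = x) \<and> (\<forall>x. mul x one = x)"

definition unital_basis :: "'a::real_vector \<Rightarrow> (3 \<Rightarrow> 'a) \<Rightarrow> bool" where
  "unital_basis one e \<longleftrightarrow>
     inj e \<and> independent (range e) \<and> span (range e) = UNIV \<and> e 0 = one"

text \<open>
  The index type \<^typ>\<open>3\<close> has the elements 0, 1, 2 (and 3 = 0), so it carries the
  index set of the basis \<open>e\<^sub>0, e\<^sub>1, e\<^sub>2\<close> as it stands. The two maps below identify the algebra with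
  \<^typ>\<open>real^3\<close>; from \<open>coord_mult\<close> on, all elements of the algebra are coordinate vectors.
\<close>

definition from_coords :: "(3 \<Rightarrow> 'a::real_vector) \<Rightarrow> real^3 \<Rightarrow> 'a" where
  "from_coords e x = (\<Sum>i\<in>UNIV. (x $ i) *\<^sub>R e i)"

definition to_coords :: "(3 \<Rightarrow> 'a::real_vector) \<Rightarrow> 'a \<Rightarrow> real^3" where
  "to_coords e v = (\<chi> i. representation (range e) v (e i))"

definition coord_mult ::
  "(3 \<Rightarrow> 'a::real_vector) \<Rightarrow> ('a \<Rightarrow> 'a \<Rightarrow> 'a) \<Rightarrow> real^3 \<Rightarrow> real^3 \<Rightarrow> real^3" where
  "coord_mult e mul x y = to_coords e (mul (from_coords e x) (from_coords e y))"


section \<open>Differentiability classes\<close>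

definition partial :: "3 \<Rightarrow> (real^3 \<Rightarrow> 'b::real_normed_vector) \<Rightarrow> real^3 \<Rightarrow> 'b" where
  "partial j f x = frechet_derivative f (at x) (axis j 1)"

text \<open>
  \<open>S\<close> is either open or the closure of a domain with smooth boundary; derivatives at boundary
  points are relative to \<open>S\<close>.
\<close>

definition C1_on :: "'a::real_normed_vector set \<Rightarrow> ('a \<Rightarrow> 'b::real_normed_vector) \<Rightarrow> bool" where
  "C1_on S f \<longleftrightarrow>
     (\<exists>f'. (\<forall>x\<in>S. (f has_derivative blinfun_apply (f' x)) (at x within S)) \<and> continuous_on S f')"

primrec Ck_on :: "nat \<Rightarrow> (real^3) set \<Rightarrow> (real^3 \<Rightarrow> real) \<Rightarrow> bool" where
  "Ck_on 0 U r \<longleftrightarrow> continuous_on U r"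
| "Ck_on (Suc k) U r \<longleftrightarrow> r differentiable_on U \<and> (\<forall>j. Ck_on k U (partial j r))"

definition smooth_on :: "(real^3) set \<Rightarrow> (real^3 \<Rightarrow> real) \<Rightarrow> bool" where
  "smooth_on U r \<longleftrightarrow> (\<forall>k. Ck_on k U r)"


section \<open>Domains with smooth boundary\<close>

definition gradient :: "(real^3 \<Rightarrow> real) \<Rightarrow> real^3 \<Rightarrow> real^3" where
  "gradient r x = (\<chi> j. partial j r x)"

definition defining_function ::
  "(real^3) set \<Rightarrow> real^3 \<Rightarrow> (real^3) set \<Rightarrow> (real^3 \<Rightarrow> real) \<Rightarrow> bool" where
  "defining_function D p U r \<longleftrightarrow>
     open U \<and> p \<in> U \<and> smooth_on U r \<and> (\<forall>y\<in>U. gradient r y \<noteq> 0) \<and>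
     D \<inter> U = {y \<in> U. r y < 0}"

definition smooth_bounded_domain :: "(real^3) set \<Rightarrow> bool" where
  "smooth_bounded_domain D \<longleftrightarrow>
     open D \<and> connected D \<and> D \<noteq> {} \<and> bounded D \<and>
     (\<forall>p\<in>frontier D. \<exists>U r. defining_function D p U r)"

definition outward_normal :: "(real^3) set \<Rightarrow> real^3 \<Rightarrow> real^3 \<Rightarrow> bool" where
  "outward_normal D p \<nu> \<longleftrightarrow> (\<exists>U r. defining_function D p U r \<and> \<nu> = gradient r p)"


section \<open>Integration of 2-forms over the oriented boundary\<close>

text \<open>\<open>dy_hat j\<close> is \<open>dy\<^sub>0 \<and> dy\<^sub>1 \<and> dy\<^sub>2\<close> with \<open>dy\<^sub>j\<close> omitted, as an alternating bilinear form.\<close>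

definition dy_wedge :: "3 \<Rightarrow> 3 \<Rightarrow> real^3 \<Rightarrow> real^3 \<Rightarrow> real" where
  "dy_wedge i k v w = v $ i * w $ k - v $ k * w $ i"

definition dy_hat :: "3 \<Rightarrow> real^3 \<Rightarrow> real^3 \<Rightarrow> real" where
  "dy_hat j = (if j = 0 then dy_wedge 1 2 else if j = 1 then dy_wedge 0 2 else dy_wedge 0 1)"

text \<open>\<open>dy\<^sub>0 \<and> dy\<^sub>1 \<and> dy\<^sub>2\<close> evaluated at three vectors.\<close>

definition volume_form :: "real^3 \<Rightarrow> real^3 \<Rightarrow> real^3 \<Rightarrow> real" where
  "volume_form u v w = det (\<chi> k. if k = 0 then u else if k = 1 then v else w)"

definition tangent1 :: "(real \<times> real \<Rightarrow> real^3) \<Rightarrow> real \<times> real \<Rightarrow> real^3" where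
  "tangent1 \<sigma> u = frechet_derivative \<sigma> (at u) (1, 0)"

definition tangent2 :: "(real \<times> real \<Rightarrow> real^3) \<Rightarrow> real \<times> real \<Rightarrow> real^3" where
  "tangent2 \<sigma> u = frechet_derivative \<sigma> (at u) (0, 1)"

text \<open>
  Positively oriented regular parametrizations; regularity is part of the orientation condition,
  which is the convention ``outward normal first''.
\<close>

definition oriented_param ::
  "(real^3) set \<Rightarrow> (real \<times> real) set \<Rightarrow> (real \<times> real \<Rightarrow> real^3) \<Rightarrow> bool" where
  "oriented_param D U \<sigma> \<longleftrightarrow>
     open U \<and> C1_on U \<sigma> \<and> inj_on \<sigma> U \<and> \<sigma> ` U \<subseteq> frontier D \<and>
     (\<forall>u\<in>U. \<exists>\<nu>. outward_normal D (\<sigma> u) \<nu> \<and>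
                volume_form \<nu> (tangent1 \<sigma> u) (tangent2 \<sigma> u) > 0)"

text \<open>
  A decomposition cuts the boundary into finitely many disjoint Borel pieces \<open>\<sigma> k ` B k\<close>, each
  lying in the image of a positively oriented parametrization. The integral of a 2-form is the sum
  of the integrals of its pullbacks over the pieces. For a continuous form on a smooth compact
  boundary this does not depend on the decomposition, by change of variables; as for other
  \<open>has_\<dots>\<close> integrals the value is fixed by a relation.
\<close>

definition boundary_decomposition ::
  "(real^3) set \<Rightarrow> nat \<Rightarrow> (nat \<Rightarrow> (real \<times> real) set) \<Rightarrow> (nat \<Rightarrow> real \<times> real \<Rightarrow> real^3) \<Rightarrow>
   (nat \<Rightarrow> (real \<times> real) set) \<Rightarrow> bool" where
  "boundary_decomposition D n U \<sigma> B \<longleftrightarrow>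
     (\<forall>k<n. oriented_param D (U k) (\<sigma> k) \<and> B k \<subseteq> U k \<and> B k \<in> sets borel) \<and>
     disjoint_family_on (\<lambda>k. \<sigma> k ` B k) {..<n} \<and>
     (\<Union>k<n. \<sigma> k ` B k) = frontier D"

definition pullback ::
  "(real \<times> real \<Rightarrow> real^3) \<Rightarrow> (real^3 \<Rightarrow> real^3 \<Rightarrow> real^3 \<Rightarrow> real^3) \<Rightarrow> real \<times> real \<Rightarrow> real^3" where
  "pullback \<sigma> \<omega> u = \<omega> (\<sigma> u) (tangent1 \<sigma> u) (tangent2 \<sigma> u)"

definition has_boundary_integral ::
  "(real^3 \<Rightarrow> real^3 \<Rightarrow> real^3 \<Rightarrow> real^3) \<Rightarrow> real^3 \<Rightarrow> (real^3) set \<Rightarrow> bool" where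
  "has_boundary_integral \<omega> I D \<longleftrightarrow>
     (\<exists>n U \<sigma> B. boundary_decomposition D n U \<sigma> B) \<and>
     (\<forall>n U \<sigma> B. boundary_decomposition D n U \<sigma> B \<longrightarrow>
        (\<forall>k<n. set_integrable lborel (B k) (pullback (\<sigma> k) \<omega>)) \<and>
        (\<Sum>k<n. set_lebesgue_integral lborel (B k) (pullback (\<sigma> k) \<omega>)) = I)"


section \<open>Cauchy condition and Cauchy formula\<close>

text \<open>Throughout, \<open>m\<close> is the multiplication of the algebra in coordinates.\<close>

definition cauchy_condition ::
  "(real^3 \<Rightarrow> real^3 \<Rightarrow> real^3) \<Rightarrow> (3 \<Rightarrow> real^3) \<Rightarrow> (real^3) set \<Rightarrow> (real^3 \<Rightarrow> real^3) \<Rightarrow> bool" where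
  "cauchy_condition m a D f \<longleftrightarrow> (\<forall>x\<in>D. (\<Sum>j\<in>UNIV. m (a j) (partial j f x)) = 0)"

definition phi :: "(3 \<Rightarrow> real^3) \<Rightarrow> real^3 \<Rightarrow> real^3 \<Rightarrow> real^3" where
  "phi b x y = (\<Sum>i\<in>UNIV. (y $ i - x $ i) *\<^sub>R b i)"

definition cauchy_coeff ::
  "(real^3 \<Rightarrow> real^3 \<Rightarrow> real^3) \<Rightarrow> (3 \<Rightarrow> real^3) \<Rightarrow> (3 \<Rightarrow> real^3) \<Rightarrow> real^3 \<Rightarrow> real^3 \<Rightarrow> 3 \<Rightarrow> real^3"
where
  "cauchy_coeff m a b x y j = m (a j) (phi b x y) /\<^sub>R norm (y - x) ^ 3"

definition cauchy_form ::
  "(real^3 \<Rightarrow> real^3 \<Rightarrow> real^3) \<Rightarrow> (3 \<Rightarrow> real^3) \<Rightarrow> (3 \<Rightarrow> real^3) \<Rightarrow> real^3 \<Rightarrow>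
   real^3 \<Rightarrow> real^3 \<Rightarrow> real^3 \<Rightarrow> real^3" where
  "cauchy_form m a b x y v w =
     dy_hat 0 v w *\<^sub>R cauchy_coeff m a b x y 0
     - dy_hat 1 v w *\<^sub>R cauchy_coeff m a b x y 1
     + dy_hat 2 v w *\<^sub>R cauchy_coeff m a b x y 2"

definition admits_cauchy_formula ::
  "(real^3 \<Rightarrow> real^3 \<Rightarrow> real^3) \<Rightarrow> (3 \<Rightarrow> real^3) \<Rightarrow> bool" where
  "admits_cauchy_formula m a \<longleftrightarrow>
     (\<exists>b. \<forall>D f. smooth_bounded_domain D \<longrightarrow> C1_on (closure D) f \<longrightarrow> cauchy_condition m a D f \<longrightarrow>
        (\<forall>x\<in>D. has_boundary_integral (\<lambda>y v w. m (f y) (cauchy_form m a b x y v w)) (f x) D))"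

end

theory Submission
  imports Defs
begin

text \<open>
  Write \<open>A y = \<Sum> y\<^sub>j a\<^sub>j\<close>, \<open>B y = \<Sum> y\<^sub>j b\<^sub>j\<close> and \<open>E\<close> for the unit. The form under the integral is
  \<open>A (dS) B (y - x) / |y - x|\<^sup>3\<close>, where \<open>dS\<close> is the vectorial surface element. A single point, \<open>x = 0\<close>,
  and a single family of domains suffice: the ellipsoids of revolution
  \<open>|y| + \<epsilon> r \<bullet> y < 1\<close> with \<open>|r| = 1\<close> and \<open>0 \<le> \<epsilon> < 1\<close>, which have a focus at 0. On the boundary
  \<open>y = n / (1 + \<epsilon> r \<bullet> n)\<close> with a unit vector \<open>n\<close>, and the surface element is \<open>|y|\<^sup>3 (n + \<epsilon> r) d\<omega>\<close>.
  The power of \<open>|y|\<close> cancels, and in the area-preserving cylindrical coordinates of the sphere,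
  \<open>n = sqrt (1 - w\<^sup>2) (cos \<theta> p + sin \<theta> q) + w r\<close>, the integral over \<open>\<theta>\<close> leaves only the
  products \<open>A p B p + A q B q\<close> and \<open>A r B r\<close>, each with a scalar weight that depends on \<open>\<epsilon>\<close>
  (\<open>boundary_identity\<close>).

  The constant function \<open>E\<close> satisfies every Cauchy condition. Applied to it, a sphere (\<open>\<epsilon> = 0\<close>) and
  a proper ellipsoid (\<open>\<epsilon> = 1/2\<close>) weight the two products differently, so they determine
  \<open>A r B r = E / (4 \<pi>)\<close> for every unit vector \<open>r\<close> (\<open>unit_products\<close>). Polarization yields
  \<open>A v B w + A w B v = 0\<close> for orthogonal \<open>v\<close>, \<open>w\<close>.

  In an associative algebra these relations survive as identities between the matrices of left
  multiplications, and their determinants contradict each other because 3 is odd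
  (\<open>associative_contradiction\<close>). Behind this is the fact that \<open>inverse (A v) A w\<close> would square to a
  negative multiple of the unit and so act as a complex structure on a space of dimension 3.

  In a commutative algebra the relations alone are consistent: they hold in the algebra with basis
  \<open>E, u, v\<close> and \<open>u\<^sup>2 = v\<^sup>2 = -E\<close>, \<open>u v = 0\<close>, and this is essentially the only possibility. But then
  orthonormal \<open>p\<close>, \<open>q\<close> exist with \<open>A p A q = 0\<close>, so the linear function \<open>(p \<bullet> y) A q\<close> satisfies the
  Cauchy condition and vanishes at 0, while its integral over the ellipsoid with axis \<open>p\<close> and
  \<open>\<epsilon> = 1/2\<close> is a negative multiple of \<open>A q\<close> (\<open>commutative_contradiction\<close>).
\<close>

section \<open>Multiplication in coordinates\<close>

lemma linear_from_coords: "linear (from_coords e)"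
  by (rule linearI)
     (auto simp: from_coords_def scaleR_add_left sum.distrib scaleR_sum_right)

lemma linear_to_coords:
  assumes "unital_basis one e"
  shows "linear (to_coords e)"
  using assms unfolding unital_basis_def to_coords_def
  by (intro linearI) (auto simp: vec_eq_iff representation_add representation_scale)

lemma from_to_coords:
  assumes "unital_basis one e"
  shows "from_coords e (to_coords e v) = v"
proof -
  from assms have e: "inj e" "independent (range e)" "span (range e) = UNIV"
    by (auto simp: unital_basis_def)
  have "from_coords e (to_coords e v) = (\<Sum>b\<in>range e. representation (range e) v b *\<^sub>R b)"
    by (simp add: from_coords_def to_coords_def sum.reindex[OF e(1)])
  also have "\<dots> = v"
    using e by (intro sum_representation_eq) auto
  finally show ?thesis .
qed

lemma to_from_coords:
  assumes "unital_basis one e"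
  shows "to_coords e (from_coords e x) = x"
proof -
  from assms have e: "inj e" "independent (range e)" "span (range e) = UNIV"
    by (auto simp: unital_basis_def)
  have "to_coords e (from_coords e x) = (\<Sum>i\<in>UNIV. x $ i *\<^sub>R to_coords e (e i))"
    unfolding from_coords_def
    using linear_to_coords[OF assms] by (simp add: linear_sum linear_scale)
  also have "\<dots> = x"
    using e by (auto simp: vec_eq_iff to_coords_def representation_basis inj_eq if_distrib cong: if_cong)
  finally show ?thesis .
qed

lemma to_coords_one:
  assumes "unital_basis one e"
  shows "to_coords e one = axis 0 1"
  using assms by (auto simp: unital_basis_def to_coords_def vec_eq_iff representation_basis axis_def inj_eq)

lemma coord_mult_bilinear:
  assumes "unital_algebra mul one" "unital_basis one e"
  shows "bilinear (coord_mult e mul)"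
proof -
  have "bilinear mul" using assms by (simp add: unital_algebra_def)
  then show ?thesis
    using linear_from_coords[of e] linear_to_coords[OF assms(2)]
    by (auto simp: bilinear_def coord_mult_def linear_iff)
qed

lemma coord_mult_unit:
  assumes "unital_algebra mul one" "unital_basis one e"
  shows "coord_mult e mul (axis 0 1) x = x" "coord_mult e mul x (axis 0 1) = x"
  using assms from_to_coords[OF assms(2), of one] to_from_coords[OF assms(2), of x]
  by (simp_all add: coord_mult_def unital_algebra_def to_coords_one)

lemma square_form_polarized:
  fixes q :: "'a::real_inner \<Rightarrow> 'a \<Rightarrow> 'b::real_vector"
  assumes q: "bilinear q" and unit: "\<And>v. norm v = 1 \<Longrightarrow> q v v = c"
  shows "q v w + q w v = (2 * inner v w) *\<^sub>R c"
proof -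
  have sq: "q v v = (inner v v) *\<^sub>R c" for v
  proof (cases "v = 0")
    case False
    have "norm v *\<^sub>R sgn v = v" using False by (simp add: sgn_div_norm)
    then have "q v v = q (norm v *\<^sub>R sgn v) (norm v *\<^sub>R sgn v)" by simp
    also have "\<dots> = (norm v * norm v) *\<^sub>R q (sgn v) (sgn v)"
      using q by (simp only: bilinear_lmul bilinear_rmul) simp
    finally show ?thesis
      using False unit[of "sgn v"] by (simp add: norm_sgn dot_square_norm power2_eq_square)
  qed (use q in \<open>simp add: bilinear_lzero\<close>)
  have "q v w + q w v = q (v + w) (v + w) - q v v - q w w"
    using q by (simp add: bilinear_ladd bilinear_radd)
  also have "\<dots> = (inner (v + w) (v + w) - inner v v - inner w w) *\<^sub>R c"
    by (simp only: sq scaleR_diff_left)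
  also have "inner (v + w) (v + w) - inner v v - inner w w = 2 * inner v w"
    by (simp add: inner_add_left inner_add_right inner_commute)
  finally show ?thesis .
qed

text \<open>
  For orthonormal \<open>u\<close>, \<open>v\<close> the determinants of the left multiplications satisfy
  \<open>|A u| |B u| = |A v| |B v| = \<mu>\<^sup>3\<close>, and \<open>A u B v = - A v B u\<close> becomes
  \<open>|A u| |B v| = - |A v| |B u|\<close> since the dimension is odd. So \<open>\<mu>\<^sup>6\<close> is minus a square.
\<close>

lemma associative_contradiction:
  fixes m :: "real^3 \<Rightarrow> real^3 \<Rightarrow> real^3" and A B :: "real^3 \<Rightarrow> real^3"
  assumes m: "bilinear m" and unit: "\<And>x. m E x = x"
    and assoc: "\<And>x y z. m (m x y) z = m x (m y z)"
    and A: "linear A" and B: "linear B"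
    and q: "\<And>v. norm v = 1 \<Longrightarrow> m (A v) (B v) = \<mu> *\<^sub>R E" and \<mu>: "\<mu> \<noteq> 0"
  shows False
proof -
  define L where "L x = matrix (m x)" for x
  have lin: "linear (m x)" for x using m by (simp add: bilinear_def)
  have L_mult: "L (m x y) = L x ** L y" for x y
  proof -
    have "m (m x y) = m x \<circ> m y" by (auto simp: assoc)
    then show ?thesis by (simp add: L_def matrix_compose lin)
  qed
  have L_unit: "det (L (\<nu> *\<^sub>R E)) = \<nu> ^ 3" for \<nu>
  proof -
    have "m (\<nu> *\<^sub>R E) = (\<lambda>x. \<nu> *\<^sub>R x)" using m by (auto simp: bilinear_lmul unit)
    then show ?thesis
      by (simp add: L_def matrix_scaleR det_3 mat_def power3_eq_cube)
  qed
  have "bilinear (\<lambda>v w. m (A v) (B w))"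
    using m A B by (auto simp: bilinear_def intro: linear_compose[unfolded o_def])
  from square_form_polarized[OF this q]
  have pol: "m (A v) (B w) + m (A w) (B v) = (2 * inner v w) *\<^sub>R \<mu> *\<^sub>R E" for v w .
  define u v :: "real^3" where "u = axis 1 1" and "v = axis 2 1"
  have uv: "norm u = 1" "norm v = 1" "inner u v = 0"
    by (auto simp: u_def v_def inner_axis_axis)
  have "m (A u) (B v) = (- 1) *\<^sub>R m (A v) (B u)"
    using pol[of u v] uv by (simp add: add_eq_0_iff)
  also have "\<dots> = m ((- 1) *\<^sub>R E) (m (A v) (B u))"
    using m by (simp only: bilinear_lmul unit)
  finally have "det (L (m (A u) (B v))) = det (L (m ((- 1) *\<^sub>R E) (m (A v) (B u))))" by simp
  then have cross: "det (L (A u)) * det (L (B v)) = - (det (L (A v)) * det (L (B u)))"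
    by (simp only: L_mult det_mul L_unit) simp
  have "det (L (m (A u) (B u))) = \<mu> ^ 3" "det (L (m (A v) (B v))) = \<mu> ^ 3"
    using q[OF uv(1)] q[OF uv(2)] L_unit by simp_all
  then have uu: "det (L (A u)) * det (L (B u)) = \<mu> ^ 3"
    and vv: "det (L (A v)) * det (L (B v)) = \<mu> ^ 3" by (simp_all only: L_mult det_mul)
  have "\<mu> ^ 3 * \<mu> ^ 3 = (det (L (A u)) * det (L (B v))) * (det (L (A v)) * det (L (B u)))"
    by (subst uu[symmetric], subst vv[symmetric]) (simp only: mult_ac)
  then have "\<mu> ^ 3 * \<mu> ^ 3 = - (det (L (A v)) * det (L (B u)))\<^sup>2"
    by (simp only: cross power2_eq_square) simp
  moreover have "\<mu> ^ 3 * \<mu> ^ 3 > 0" using \<mu> by (simp add: zero_less_mult_iff linorder_neq_iff)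
  ultimately show False by (smt (verit) zero_le_power2)
qed

section \<open>Ellipsoids with a focus at the origin\<close>

text \<open>
  For \<open>norm g < 1\<close> this is the interior of the ellipsoid of revolution with axis along \<open>g\<close>,
  eccentricity \<open>norm g\<close> and one focus at the origin. Placing the focus at the pole of the
  kernel is what makes the integrals elementary.
\<close>

definition focal_ellipsoid :: "real^3 \<Rightarrow> (real^3) set" where
  "focal_ellipsoid g = {y. norm y + inner g y < 1}"

lemma focal_bound:
  fixes g :: "real^3"
  shows "norm y * (1 - norm g) \<le> norm y + inner g y"
  using norm_cauchy_schwarz[of "- g" y] by (simp add: algebra_simps)

lemma partial_eq:
  assumes "(f has_derivative f') (at x)"
  shows "partial j f x = f' (axis j 1)"
  using frechet_derivative_at[OF assms] by (simp add: partial_def)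

lemma smooth_const: "Ck_on k U (\<lambda>_. c)"
proof (induction k arbitrary: c)
  case (Suc k)
  have "partial j (\<lambda>_. c) = (\<lambda>_. 0)" for j
    using partial_eq[OF has_derivative_const] by (auto simp: fun_eq_iff)
  then show ?case using Suc by simp
qed simp

lemma smooth_affine: "Ck_on k U (\<lambda>y. c + inner d y)"
proof (cases k)
  case (Suc l)
  have der: "((\<lambda>y. c + inner d y) has_derivative (\<lambda>h. inner d h)) (at y within S)" for y S
    by (auto intro!: derivative_eq_intros)
  have "partial j (\<lambda>y. c + inner d y) = (\<lambda>_. d $ j)" for j
    using partial_eq[OF der] by (auto simp: fun_eq_iff inner_axis)
  then show ?thesis
    using der by (auto simp: Suc smooth_const differentiable_on_def differentiable_def)
qed (auto intro!: continuous_intros)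

lemma quadric_derivative:
  fixes g :: "real^3"
  shows "((\<lambda>y. inner y y - (1 - inner g y)\<^sup>2) has_derivative
          (\<lambda>h. inner (2 *\<^sub>R y + (2 * (1 - inner g y)) *\<^sub>R g) h)) (at y within S)"
  by (auto intro!: derivative_eq_intros simp: fun_eq_iff algebra_simps inner_commute inner_add_left)

lemma gradient_quadric:
  fixes g :: "real^3"
  shows "gradient (\<lambda>y. inner y y - (1 - inner g y)\<^sup>2) y = 2 *\<^sub>R y + (2 * (1 - inner g y)) *\<^sub>R g"
  using partial_eq[OF quadric_derivative[of g y UNIV]]
  by (simp add: gradient_def vec_eq_iff inner_axis)

text \<open>
  Squaring \<open>|y| < 1 - g \<bullet> y\<close> replaces the norm, which is not smooth at the focus, by a
  polynomial whose gradient is affine, so differentiability of all orders is immediate.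
\<close>

lemma smooth_quadric:
  fixes g :: "real^3"
  shows "smooth_on U (\<lambda>y. inner y y - (1 - inner g y)\<^sup>2)"
  unfolding smooth_on_def
proof
  fix k
  let ?r = "\<lambda>y. inner y y - (1 - inner g y)\<^sup>2"
  show "Ck_on k U ?r"
  proof (cases k)
    case (Suc l)
    have "partial j ?r = (\<lambda>y. 2 * g $ j + inner (2 *\<^sub>R axis j 1 - (2 * g $ j) *\<^sub>R g) y)" for j
      using partial_eq[OF quadric_derivative[of g _ UNIV]]
      by (auto simp: fun_eq_iff inner_axis inner_axis' algebra_simps inner_diff_left)
    moreover have "?r differentiable_on U"
      using quadric_derivative[of g] unfolding differentiable_on_def differentiable_def by blast
    ultimately show ?thesis by (simp add: Suc smooth_affine)
  qed (auto intro!: continuous_intros)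
qed

lemma frontier_focal_ellipsoid:
  assumes g: "norm g < 1"
  shows "frontier (focal_ellipsoid g) = {y. norm y + inner g y = 1}"
proof -
  have op: "open (focal_ellipsoid g)"
    unfolding focal_ellipsoid_def by (intro open_Collect_less continuous_intros)
  have "closure (focal_ellipsoid g) \<subseteq> {y. norm y + inner g y \<le> 1}"
    unfolding focal_ellipsoid_def
    by (intro closure_minimal closed_Collect_le continuous_intros) auto
  moreover have "y \<in> closure (focal_ellipsoid g)" if y: "norm y + inner g y = 1" for y
  proof -
    have "(\<lambda>n. (1 - inverse (real (Suc n))) *\<^sub>R y) \<longlonglongrightarrow> (1 - 0) *\<^sub>R y"
      by (intro tendsto_intros LIMSEQ_inverse_real_of_nat)
    moreover have "(1 - inverse (real (Suc n))) *\<^sub>R y \<in> focal_ellipsoid g" for n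
    proof -
      let ?t = "1 - inverse (real (Suc n))"
      have t: "0 \<le> ?t" "?t < 1"
        using inverse_le_1_iff[of "real (Suc n)"] by simp_all
      have "norm (?t *\<^sub>R y) + inner g (?t *\<^sub>R y) = ?t * (norm y + inner g y)"
        using t(1) by (simp only: norm_scaleR abs_of_nonneg inner_scaleR_right distrib_left)
      then show ?thesis using t y by (simp add: focal_ellipsoid_def)
    qed
    ultimately show ?thesis unfolding closure_sequential by fastforce
  qed
  ultimately show ?thesis
    using op by (auto simp: frontier_def interior_open focal_ellipsoid_def)
qed

text \<open>
  The gradient of the quadric vanishes at the center of the ellipsoid. Restricting to the points
  where the radial derivative is positive keeps the whole boundary and removes the center.
\<close>

lemma focal_defining_function:
  assumes g: "norm g < 1" and p: "norm p + inner g p = 1"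
  shows "\<exists>U. defining_function (focal_ellipsoid g) p U (\<lambda>y. inner y y - (1 - inner g y)\<^sup>2)"
proof -
  let ?G = "\<lambda>y. 2 *\<^sub>R y + (2 * (1 - inner g y)) *\<^sub>R g"
  define U where "U = {y. inner g y < 1} \<inter> {y. 0 < inner y (?G y)}"
  have "open U"
    unfolding U_def by (intro open_Int open_Collect_less continuous_intros)
  moreover have "p \<in> U"
  proof -
    have "p \<noteq> 0" using p by auto
    then have pos: "norm p > 0" by simp
    have gp: "inner g p = 1 - norm p" using p by simp
    have "inner p (?G p) = 2 * (norm p)\<^sup>2 + 2 * (1 - inner g p) * inner g p"
      by (simp add: inner_add_right inner_commute[of p g] dot_square_norm)
    also have "\<dots> = 2 * norm p" unfolding gp by (simp add: power2_eq_square algebra_simps)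
    finally show ?thesis using pos gp by (auto simp: U_def)
  qed
  moreover have "focal_ellipsoid g \<inter> U = {y \<in> U. inner y y - (1 - inner g y)\<^sup>2 < 0}"
  proof -
    have "norm y + inner g y < 1 \<longleftrightarrow> inner y y - (1 - inner g y)\<^sup>2 < 0" if "inner g y < 1" for y
      using that power_mono_iff[of "1 - inner g y" "norm y" 2]
      by (auto simp: dot_square_norm not_le[symmetric])
    then show ?thesis by (auto simp: U_def focal_ellipsoid_def)
  qed
  moreover have "\<forall>y\<in>U. ?G y \<noteq> 0" unfolding U_def by force
  ultimately have "defining_function (focal_ellipsoid g) p U (\<lambda>y. inner y y - (1 - inner g y)\<^sup>2)"
    unfolding defining_function_def gradient_quadric by (intro conjI smooth_quadric)
  then show ?thesis by (rule exI)
qed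

lemma smooth_focal_ellipsoid:
  assumes g: "norm g < 1"
  shows "smooth_bounded_domain (focal_ellipsoid g)"
proof -
  have "open (focal_ellipsoid g)"
    unfolding focal_ellipsoid_def by (intro open_Collect_less continuous_intros)
  moreover have "convex (focal_ellipsoid g)"
    unfolding convex_alt
  proof (intro ballI allI impI)
    fix x y u assume xy: "x \<in> focal_ellipsoid g" "y \<in> focal_ellipsoid g" and u: "0 \<le> u \<and> u \<le> (1::real)"
    have "norm ((1 - u) *\<^sub>R x + u *\<^sub>R y) + inner g ((1 - u) *\<^sub>R x + u *\<^sub>R y)
        \<le> (1 - u) * (norm x + inner g x) + u * (norm y + inner g y)"
      using norm_triangle_ineq[of "(1 - u) *\<^sub>R x" "u *\<^sub>R y"] u
      by (simp add: inner_add_right distrib_left)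
    also have "\<dots> < 1"
      using xy u by (intro convex_bound_lt) (auto simp: focal_ellipsoid_def)
    finally show "(1 - u) *\<^sub>R x + u *\<^sub>R y \<in> focal_ellipsoid g" by (simp add: focal_ellipsoid_def)
  qed
  moreover have "0 \<in> focal_ellipsoid g" by (simp add: focal_ellipsoid_def)
  moreover have "bounded (focal_ellipsoid g)"
  proof (rule boundedI)
    fix y assume "y \<in> focal_ellipsoid g"
    then have "norm y * (1 - norm g) \<le> 1"
      using focal_bound[of y g] by (simp add: focal_ellipsoid_def)
    then show "norm y \<le> 1 / (1 - norm g)" using g by (simp add: field_simps)
  qed
  moreover have "\<forall>p\<in>frontier (focal_ellipsoid g). \<exists>U r. defining_function (focal_ellipsoid g) p U r"
    using focal_defining_function[OF g] unfolding frontier_focal_ellipsoid[OF g] by blast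
  ultimately show ?thesis
    by (auto simp: smooth_bounded_domain_def convex_connected)
qed

lemma focal_outward_normal:
  assumes g: "norm g < 1" and p: "norm p + inner g p = 1"
  shows "outward_normal (focal_ellipsoid g) p ((2 * norm p) *\<^sub>R (sgn p + g))"
proof -
  have "1 - inner g p = norm p" using p by simp
  moreover have "norm p *\<^sub>R sgn p = p" using p by (cases "p = 0") (auto simp: sgn_div_norm)
  ultimately have "gradient (\<lambda>y. inner y y - (1 - inner g y)\<^sup>2) p = (2 * norm p) *\<^sub>R (sgn p + g)"
    unfolding gradient_quadric by (metis scaleR_add_right scaleR_scaleR)
  then show ?thesis
    using focal_defining_function[OF g p] unfolding outward_normal_def by (elim exE) (auto intro!: exI)
qed

section \<open>Cylindrical charts\<close>

definition oriented_frame :: "real^3 \<Rightarrow> real^3 \<Rightarrow> real^3 \<Rightarrow> bool" where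
  "oriented_frame p q r \<longleftrightarrow> norm p = 1 \<and> norm q = 1 \<and> inner p q = 0 \<and> r = cross3 p q"

lemma frame_cross:
  assumes "oriented_frame p q r"
  shows "cross3 p q = r" "cross3 q r = p" "cross3 r p = q"
proof -
  from assms have *: "inner p p = 1" "inner q q = 1" "inner p q = 0" "r = cross3 p q"
    by (auto simp: oriented_frame_def dot_square_norm)
  show "cross3 p q = r" by (simp add: *)
  show "cross3 q r = p" using * by (simp add: Lagrange inner_commute)
  show "cross3 r p = q" using * by (subst cross_skew) (simp add: Lagrange inner_commute)
qed

lemma frame_inner:
  assumes "oriented_frame p q r"
  shows "inner p p = 1" "inner q q = 1" "inner r r = 1"
    "inner p q = 0" "inner q p = 0" "inner p r = 0" "inner r p = 0" "inner q r = 0" "inner r q = 0"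
proof -
  from assms have *: "inner p p = 1" "inner q q = 1" "inner p q = 0" "r = cross3 p q"
    by (auto simp: oriented_frame_def dot_square_norm)
  then show "inner p p = 1" "inner q q = 1" "inner p q = 0" "inner q p = 0"
    by (simp_all add: inner_commute)
  show "inner p r = 0" "inner r p = 0" "inner q r = 0" "inner r q = 0"
    by (simp_all add: *(4) dot_cross_self)
  show "inner r r = 1" using * by (simp add: dot_cross inner_commute)
qed

lemma frame_rotate:
  assumes "oriented_frame p q r"
  shows "oriented_frame r p q"
  using frame_inner[OF assms] frame_cross[OF assms]
  by (simp add: oriented_frame_def norm_eq_sqrt_inner)

lemma frame_exists:
  fixes r :: "real^3"
  assumes r: "norm r = 1"
  obtains p q where "oriented_frame p q r"
proof -
  obtain z where z: "z \<noteq> 0" "orthogonal r z"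
    using orthogonal_to_vector_exists[of r] by (auto simp: eval_nat_numeral)
  have "inner r (sgn z) = 0" using z by (simp add: orthogonal_def sgn_div_norm)
  moreover have "norm (sgn z) = 1" using z by (simp add: norm_sgn)
  moreover from calculation have "(norm (cross3 r (sgn z)))\<^sup>2 = 1"
    using norm_cross[of r "sgn z"] r by simp
  ultimately have "oriented_frame r (sgn z) (cross3 r (sgn z))"
    using r by (simp add: oriented_frame_def)
  then have "oriented_frame (sgn z) (cross3 r (sgn z)) r"
    using frame_rotate by blast
  then show thesis by (rule that)
qed

text \<open>
  A vector orthogonal to the whole frame has vanishing cross product with \<open>p\<close>, hence is
  parallel to \<open>p\<close>, hence zero.
\<close>

lemma frame_expansion:
  assumes "oriented_frame p q r"
  shows "y = inner p y *\<^sub>R p + inner q y *\<^sub>R q + inner r y *\<^sub>R r"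
proof -
  note I = frame_inner[OF assms] and C = frame_cross[OF assms]
  let ?d = "y - (inner p y *\<^sub>R p + inner q y *\<^sub>R q + inner r y *\<^sub>R r)"
  have d: "inner p ?d = 0" "inner q ?d = 0" "inner r ?d = 0"
    by (simp_all add: inner_diff_right inner_add_right I)
  have "cross3 ?d (cross3 p q) = 0" "cross3 ?d (cross3 q r) = 0"
    using d by (simp_all add: Lagrange inner_commute)
  then have "cross3 ?d r = 0" "cross3 ?d p = 0" by (simp_all only: C)
  then have "cross3 p (cross3 p ?d) = 0" by (subst (2) cross_skew) simp
  then have "?d = 0" using d by (simp add: Lagrange I)
  then show ?thesis by simp
qed

text \<open>
  Projecting the circumscribed cylinder onto the sphere preserves area (Archimedes). This appears
  as the absence of a density in \<open>cyl_direction_cross\<close>. The argument is (angle, height).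
\<close>

definition cyl_direction :: "real^3 \<Rightarrow> real^3 \<Rightarrow> real^3 \<Rightarrow> real \<times> real \<Rightarrow> real^3" where
  "cyl_direction p q r u =
     sqrt (1 - (snd u)\<^sup>2) *\<^sub>R (cos (fst u) *\<^sub>R p + sin (fst u) *\<^sub>R q) + snd u *\<^sub>R r"

text \<open>The partial derivatives of \<open>cyl_direction\<close> in the angle and in the height.\<close>

definition cyl_direction1 :: "real^3 \<Rightarrow> real^3 \<Rightarrow> real \<times> real \<Rightarrow> real^3" where
  "cyl_direction1 p q u = sqrt (1 - (snd u)\<^sup>2) *\<^sub>R (cos (fst u) *\<^sub>R q - sin (fst u) *\<^sub>R p)"

definition cyl_direction2 :: "real^3 \<Rightarrow> real^3 \<Rightarrow> real^3 \<Rightarrow> real \<times> real \<Rightarrow> real^3" where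
  "cyl_direction2 p q r u =
     (- snd u / sqrt (1 - (snd u)\<^sup>2)) *\<^sub>R (cos (fst u) *\<^sub>R p + sin (fst u) *\<^sub>R q) + r"

lemma sq_less_1: "\<bar>w\<bar> < 1 \<Longrightarrow> 0 < 1 - w\<^sup>2" for w :: real
  by (simp add: abs_square_less_1)

lemma cyl_direction_inner:
  assumes "oriented_frame p q r"
  shows "inner p (cyl_direction p q r u) = sqrt (1 - (snd u)\<^sup>2) * cos (fst u)"
    "inner q (cyl_direction p q r u) = sqrt (1 - (snd u)\<^sup>2) * sin (fst u)"
    "inner r (cyl_direction p q r u) = snd u"
  by (simp_all add: cyl_direction_def frame_inner[OF assms] inner_add_right)

lemma norm_cyl_direction:
  assumes F: "oriented_frame p q r" and u: "\<bar>snd u\<bar> \<le> 1"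
  shows "norm (cyl_direction p q r u) = 1"
proof -
  have s: "(sqrt (1 - (snd u)\<^sup>2))\<^sup>2 = 1 - (snd u)\<^sup>2" using u by (simp add: abs_square_le_1)
  have sq: "inner (t *\<^sub>R (c *\<^sub>R p + k *\<^sub>R q) + w *\<^sub>R r) (t *\<^sub>R (c *\<^sub>R p + k *\<^sub>R q) + w *\<^sub>R r)
      = t\<^sup>2 * (c\<^sup>2 + k\<^sup>2) + w\<^sup>2" for t c k w
    by (simp add: frame_inner[OF F] inner_add_right inner_add_left power2_eq_square algebra_simps)
  have "inner (cyl_direction p q r u) (cyl_direction p q r u)
      = (sqrt (1 - (snd u)\<^sup>2))\<^sup>2 * ((cos (fst u))\<^sup>2 + (sin (fst u))\<^sup>2) + (snd u)\<^sup>2"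
    unfolding cyl_direction_def by (rule sq)
  also have "\<dots> = 1" unfolding s by simp
  finally show ?thesis by (simp add: norm_eq_sqrt_inner)
qed

lemma cyl_direction_derivative:
  assumes u: "\<bar>snd u\<bar> < 1"
  shows "(cyl_direction p q r has_derivative
          (\<lambda>h. fst h *\<^sub>R cyl_direction1 p q u + snd h *\<^sub>R cyl_direction2 p q r u)) (at u within S)"
proof -
  let ?s = "sqrt (1 - (snd u)\<^sup>2)"
  have s: "((\<lambda>u. sqrt (1 - (snd u)\<^sup>2)) has_derivative (\<lambda>h. snd h * (- snd u / ?s))) (at u within S)"
    using sq_less_1[OF u] by (auto intro!: derivative_eq_intros simp: fun_eq_iff field_simps)
  show ?thesis
    unfolding cyl_direction_def
    by (rule derivative_eq_intros s refl)+
       (auto simp: fun_eq_iff cyl_direction1_def cyl_direction2_def algebra_simps)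
qed

lemma cyl_direction_cross:
  assumes F: "oriented_frame p q r" and u: "\<bar>snd u\<bar> < 1"
  shows "cross3 (cyl_direction1 p q u) (cyl_direction2 p q r u) = cyl_direction p q r u"
proof -
  note C = frame_cross[OF F]
  let ?s = "sqrt (1 - (snd u)\<^sup>2)"
  have C': "cross3 q p = - r" "cross3 r q = - p" "cross3 p r = - q"
    using C cross_skew by metis+
  have s: "?s > 0" using sq_less_1[OF u] by simp
  let ?c = "cos (fst u)" and ?k = "sin (fst u)" and ?w = "snd u"
  have 1: "cross3 (?c *\<^sub>R q - ?k *\<^sub>R p) (?c *\<^sub>R p + ?k *\<^sub>R q) = - r"
  proof -
    have "cross3 (?c *\<^sub>R q - ?k *\<^sub>R p) (?c *\<^sub>R p + ?k *\<^sub>R q) = - ((?c * ?c) *\<^sub>R r + (?k * ?k) *\<^sub>R r)"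
      by (simp add: Cross3.left_diff_distrib cross_add_right cross_mult_left cross_mult_right C C')
    also have "(?c * ?c) *\<^sub>R r + (?k * ?k) *\<^sub>R r = (?c * ?c + ?k * ?k) *\<^sub>R r"
      by (simp only: scaleR_add_left)
    finally show ?thesis by simp
  qed
  have 2: "cross3 (?c *\<^sub>R q - ?k *\<^sub>R p) r = ?c *\<^sub>R p + ?k *\<^sub>R q"
    by (simp add: Cross3.left_diff_distrib cross_mult_left C C')
  have 3: "cross3 (a *\<^sub>R x) (b *\<^sub>R y + z) = (a * b) *\<^sub>R cross3 x y + a *\<^sub>R cross3 x z" for a b x y z
    by (simp add: cross_add_right cross_mult_left cross_mult_right scaleR_add_right)
  show ?thesis
    unfolding cyl_direction1_def cyl_direction2_def cyl_direction_def 3 1 2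
    using s by simp
qed

definition focal_chart :: "real^3 \<Rightarrow> real^3 \<Rightarrow> real^3 \<Rightarrow> real^3 \<Rightarrow> real \<times> real \<Rightarrow> real^3" where
  "focal_chart g p q r u = inverse (1 + inner g (cyl_direction p q r u)) *\<^sub>R cyl_direction p q r u"

lemma one_plus_inner_pos:
  fixes g N :: "'a::real_inner"
  assumes "norm g < 1" "norm N = 1"
  shows "1 + inner g N > 0"
  using norm_cauchy_schwarz[of "- g" N] assms by simp

lemma focal_chart_derivative:
  assumes g: "norm g < 1" and F: "oriented_frame p q r" and u: "\<bar>snd u\<bar> < 1"
  defines "N \<equiv> cyl_direction p q r u" and "X \<equiv> cyl_direction1 p q u" and "Y \<equiv> cyl_direction2 p q r u"
  defines "\<rho> \<equiv> inverse (1 + inner g N)"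
  shows "(focal_chart g p q r has_derivative
          (\<lambda>h. fst h *\<^sub>R (\<rho> *\<^sub>R X - (\<rho>\<^sup>2 * inner g X) *\<^sub>R N) + snd h *\<^sub>R (\<rho> *\<^sub>R Y - (\<rho>\<^sup>2 * inner g Y) *\<^sub>R N)))
         (at u within S)"
proof -
  have "1 + inner g N > 0"
    using one_plus_inner_pos[OF g norm_cyl_direction[OF F]] u by (simp add: N_def)
  then have ne: "1 + inner g (cyl_direction p q r u) \<noteq> 0" by (simp add: N_def)
  show ?thesis
    unfolding focal_chart_def
    by (rule derivative_eq_intros cyl_direction_derivative[OF u] refl ne)+
       (auto simp: fun_eq_iff \<rho>_def N_def X_def Y_def power2_eq_square inner_add_right algebra_simps)
qed

text \<open>
  \<open>X\<close>, \<open>Y\<close> are tangent vectors of the unit sphere at \<open>N\<close>. Radial stretching adds multiples of \<open>N\<close>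
  to them, and the resulting correction is the part of \<open>g\<close> tangent to the sphere, because
  \<open>Y \<times> N\<close>, \<open>N \<times> X\<close>, \<open>X \<times> Y\<close> is the dual basis of \<open>X\<close>, \<open>Y\<close>, \<open>N\<close>. With \<open>\<rho> = 1 / (1 + g \<bullet> N)\<close> both
  contributions collapse to a multiple of \<open>N + g\<close>; this is special to a focus at the origin.
\<close>

lemma cross_focal:
  fixes X Y N g :: "real^3"
  assumes XY: "cross3 X Y = N" and N: "inner N N = 1" and ne: "1 + inner g N \<noteq> 0"
  defines "\<rho> \<equiv> inverse (1 + inner g N)"
  shows "cross3 (\<rho> *\<^sub>R X - (\<rho>\<^sup>2 * inner g X) *\<^sub>R N) (\<rho> *\<^sub>R Y - (\<rho>\<^sup>2 * inner g Y) *\<^sub>R N) = \<rho> ^ 3 *\<^sub>R (N + g)"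
proof -
  have "inner g X *\<^sub>R cross3 Y N + inner g Y *\<^sub>R cross3 N X + inner g N *\<^sub>R cross3 X Y
      = inner N (cross3 X Y) *\<^sub>R g"
    by (simp add: cross3_simps) (metis (full_types) exhaust_3)
  then have id: "inner g X *\<^sub>R cross3 Y N + inner g Y *\<^sub>R cross3 N X = g - inner g N *\<^sub>R N"
    by (simp add: XY N algebra_simps)
  have "cross3 (\<rho> *\<^sub>R X - (\<rho>\<^sup>2 * inner g X) *\<^sub>R N) (\<rho> *\<^sub>R Y - (\<rho>\<^sup>2 * inner g Y) *\<^sub>R N)
     = \<rho>\<^sup>2 *\<^sub>R cross3 X Y + \<rho> ^ 3 *\<^sub>R (inner g X *\<^sub>R cross3 Y N + inner g Y *\<^sub>R cross3 N X)"
    by (simp add: Cross3.left_diff_distrib Cross3.right_diff_distrib cross_mult_left cross_mult_right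
        cross_skew[of N Y] cross_skew[of X N] scaleR_add_right power2_eq_square power3_eq_cube algebra_simps)
  also have "\<dots> = \<rho> ^ 3 *\<^sub>R ((1 + inner g N) *\<^sub>R N + (g - inner g N *\<^sub>R N))"
    using ne unfolding id XY by (simp add: \<rho>_def scaleR_add_right power2_eq_square power3_eq_cube)
  finally show ?thesis by (simp add: algebra_simps)
qed

lemma volume_form_cross: "volume_form u v w = inner u (cross3 v w)"
  by (simp add: volume_form_def det_3 cross3_simps)

section \<open>Cutting the ellipsoid into two pieces\<close>

lemma mem_box_plane:
  fixes a b c d :: real
  shows "u \<in> box (a, c) (b, d) \<longleftrightarrow> a < fst u \<and> fst u < b \<and> c < snd u \<and> snd u < d"
  by (cases u) (auto simp: box_def Basis_prod_def)

lemma focal_chart_sgn: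
  assumes "norm g < 1" "oriented_frame p q r" "\<bar>snd u\<bar> \<le> 1"
  shows "sgn (focal_chart g p q r u) = cyl_direction p q r u"
  using one_plus_inner_pos[OF assms(1) norm_cyl_direction[OF assms(2,3)]] norm_cyl_direction[OF assms(2,3)]
  by (simp add: focal_chart_def sgn_scaleR) (simp add: sgn_div_norm)

lemma focal_chart_frontier:
  assumes "norm g < 1" "oriented_frame p q r" "\<bar>snd u\<bar> \<le> 1"
  shows "norm (focal_chart g p q r u) + inner g (focal_chart g p q r u) = 1"
    "norm (focal_chart g p q r u) = inverse (1 + inner g (cyl_direction p q r u))"
proof -
  let ?N = "cyl_direction p q r u"
  have N: "norm ?N = 1" using norm_cyl_direction[OF assms(2,3)] .
  have pos: "1 + inner g ?N > 0" using one_plus_inner_pos[OF assms(1) N] .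
  then show n: "norm (focal_chart g p q r u) = inverse (1 + inner g ?N)"
    by (simp add: focal_chart_def N)
  show "norm (focal_chart g p q r u) + inner g (focal_chart g p q r u) = 1"
    unfolding n using pos by (simp add: focal_chart_def) (simp add: field_simps)
qed

lemma angle_eq:
  fixes x y t :: real
  assumes "t < x" "x < t + 2 * pi" "t < y" "y < t + 2 * pi" "cos x = cos y" "sin x = sin y"
  shows "x = y"
proof -
  obtain n :: int where n: "y = x + 2 * pi * n"
    using assms(5,6) sin_cos_eq_iff[of y x] by auto
  then have "\<bar>2 * pi * n\<bar> < 2 * pi * 1" using assms(1-4) by simp
  then have "\<bar>real_of_int n\<bar> < 1" unfolding abs_mult by (simp add: mult_less_cancel_left)
  then show ?thesis using n by simp
qed

text \<open>
  The direction of a boundary point recovers the point of the sphere, so injectivity is that of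
  cylindrical coordinates.
\<close>

lemma inj_focal_chart:
  assumes g: "norm g < 1" and F: "oriented_frame p q r"
  shows "inj_on (focal_chart g p q r) (box (t, -1) (t + 2 * pi, 1))"
proof (rule inj_onI)
  fix u v assume u: "u \<in> box (t, -1) (t + 2 * pi, 1)" and v: "v \<in> box (t, -1) (t + 2 * pi, 1)"
    and eq: "focal_chart g p q r u = focal_chart g p q r v"
  have b: "t < fst u" "fst u < t + 2 * pi" "t < fst v" "fst v < t + 2 * pi" "\<bar>snd u\<bar> < 1" "\<bar>snd v\<bar> < 1"
    using u v by (auto simp: mem_box_plane)
  then have "cyl_direction p q r u = cyl_direction p q r v"
    using focal_chart_sgn[OF g F, of u] focal_chart_sgn[OF g F, of v] eq by simp
  then have *: "sqrt (1 - (snd u)\<^sup>2) * cos (fst u) = sqrt (1 - (snd v)\<^sup>2) * cos (fst v)"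
    "sqrt (1 - (snd u)\<^sup>2) * sin (fst u) = sqrt (1 - (snd v)\<^sup>2) * sin (fst v)" "snd u = snd v"
    using cyl_direction_inner[OF F, of u] cyl_direction_inner[OF F, of v] by metis+
  have "sqrt (1 - (snd v)\<^sup>2) \<noteq> 0" using sq_less_1[OF b(6)] by simp
  then have "cos (fst u) = cos (fst v)" "sin (fst u) = sin (fst v)"
    using *(1,2) unfolding *(3) mult_cancel_left by blast+
  then have "fst u = fst v" by (rule angle_eq[OF b(1-4)])
  then show "u = v" using * by (simp add: prod_eq_iff)
qed

lemma focal_chart_tangent:
  assumes g: "norm g < 1" and F: "oriented_frame p q r" and u: "\<bar>snd u\<bar> < 1"
  shows "cross3 (tangent1 (focal_chart g p q r) u) (tangent2 (focal_chart g p q r) u)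
     = norm (focal_chart g p q r u) ^ 3 *\<^sub>R (cyl_direction p q r u + g)"
proof -
  have N: "norm (cyl_direction p q r u) = 1" using norm_cyl_direction[OF F] u by simp
  have ne: "1 + inner g (cyl_direction p q r u) \<noteq> 0" using one_plus_inner_pos[OF g N] by simp
  have "tangent1 (focal_chart g p q r) u =
     (let N = cyl_direction p q r u; X = cyl_direction1 p q u; \<rho> = inverse (1 + inner g N) in
      \<rho> *\<^sub>R X - (\<rho>\<^sup>2 * inner g X) *\<^sub>R N)"
    "tangent2 (focal_chart g p q r) u =
     (let N = cyl_direction p q r u; Y = cyl_direction2 p q r u; \<rho> = inverse (1 + inner g N) in
      \<rho> *\<^sub>R Y - (\<rho>\<^sup>2 * inner g Y) *\<^sub>R N)"
    by (simp_all add: tangent1_def tangent2_def Let_def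
        frechet_derivative_at[OF focal_chart_derivative[OF g F u], symmetric])
  then show ?thesis
    using focal_chart_frontier(2)[OF g F, of u] u N ne
    by (simp add: Let_def cross_focal[OF cyl_direction_cross[OF F u]] dot_square_norm)
qed

lemma C1_focal_chart:
  assumes g: "norm g < 1" and F: "oriented_frame p q r" and U: "\<And>u. u \<in> U \<Longrightarrow> \<bar>snd u\<bar> < 1"
  shows "C1_on U (focal_chart g p q r)"
proof -
  define N where "N = cyl_direction p q r"
  define X where "X = cyl_direction1 p q"
  define Y where "Y = cyl_direction2 p q r"
  define \<rho> where "\<rho> u = inverse (1 + inner g (N u))" for u
  define T1 where "T1 u = \<rho> u *\<^sub>R X u - ((\<rho> u)\<^sup>2 * inner g (X u)) *\<^sub>R N u" for u
  define T2 where "T2 u = \<rho> u *\<^sub>R Y u - ((\<rho> u)\<^sup>2 * inner g (Y u)) *\<^sub>R N u" for u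
  have ne: "1 + inner g (N u) \<noteq> 0" if "u \<in> U" for u
    using one_plus_inner_pos[OF g norm_cyl_direction[OF F, of u]] U[OF that] by (simp add: N_def)
  have s: "sqrt (1 - (snd u)\<^sup>2) \<noteq> 0" if "u \<in> U" for u
    using sq_less_1[OF U[OF that]] by simp
  have N: "continuous_on U N"
    unfolding N_def cyl_direction_def by (intro continuous_intros)
  have X: "continuous_on U X"
    unfolding X_def cyl_direction1_def by (intro continuous_intros)
  have Y: "continuous_on U Y"
    unfolding Y_def cyl_direction2_def by (intro continuous_intros ballI s)
  have \<rho>: "continuous_on U \<rho>"
    unfolding \<rho>_def by (intro continuous_intros N ballI ne)
  have T: "continuous_on U T1" "continuous_on U T2"
    unfolding T1_def T2_def by (intro continuous_intros N X Y \<rho>)+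
  define f' :: "real \<times> real \<Rightarrow> (real \<times> real) \<Rightarrow>\<^sub>L (real^3)" where
    "f' u = (blinfun_scaleR_left (T1 u) o\<^sub>L fst_blinfun) + (blinfun_scaleR_left (T2 u) o\<^sub>L snd_blinfun)" for u
  have "continuous_on U f'"
    unfolding f'_def
    by (intro continuous_intros T bounded_linear.continuous_on[OF bounded_linear_blinfun_scaleR_left])
  moreover have "(focal_chart g p q r has_derivative blinfun_apply (f' u)) (at u within U)" if "u \<in> U" for u
  proof -
    have "blinfun_apply (f' u) = (\<lambda>h. fst h *\<^sub>R T1 u + snd h *\<^sub>R T2 u)"
      by (simp add: f'_def fun_eq_iff blinfun.add_left)
    then show ?thesis
      using focal_chart_derivative[OF g F U[OF that], of U]
      by (simp add: T1_def T2_def \<rho>_def N_def X_def Y_def)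
  qed
  ultimately show ?thesis unfolding C1_on_def by blast
qed

text \<open>
  The normal vector of the chart and the gradient of the quadric are both positive multiples of
  \<open>n + g\<close>, which is nonzero because \<open>norm g < 1\<close>.
\<close>

lemma oriented_focal_chart:
  assumes g: "norm g < 1" and F: "oriented_frame p q r"
  shows "oriented_param (focal_ellipsoid g) (box (t, -1) (t + 2 * pi, 1)) (focal_chart g p q r)"
proof -
  let ?U = "box (t, -1) (t + 2 * pi, 1) :: (real \<times> real) set"
  have b: "\<bar>snd u\<bar> < 1" if "u \<in> ?U" for u using that by (auto simp: mem_box_plane)
  have "\<exists>\<nu>. outward_normal (focal_ellipsoid g) (focal_chart g p q r u) \<nu> \<and>
      volume_form \<nu> (tangent1 (focal_chart g p q r) u) (tangent2 (focal_chart g p q r) u) > 0" if "u \<in> ?U" for u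
  proof -
    let ?N = "cyl_direction p q r u" and ?y = "focal_chart g p q r u"
    have u: "\<bar>snd u\<bar> < 1" "\<bar>snd u\<bar> \<le> 1" using b[OF that] by auto
    have N: "norm ?N = 1" using norm_cyl_direction[OF F u(2)] .
    have "?N + g \<noteq> 0" using N g by (metis add_eq_0_iff norm_minus_cancel less_irrefl)
    moreover have "norm ?y > 0"
      using focal_chart_frontier(2)[OF g F u(2)] one_plus_inner_pos[OF g N] by simp
    ultimately have "volume_form ((2 * norm ?y) *\<^sub>R (?N + g)) (tangent1 (focal_chart g p q r) u) (tangent2 (focal_chart g p q r) u) > 0"
      by (simp add: volume_form_cross focal_chart_tangent[OF g F u(1)])
    moreover have "outward_normal (focal_ellipsoid g) ?y ((2 * norm ?y) *\<^sub>R (?N + g))"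
      using focal_outward_normal[OF g focal_chart_frontier(1)[OF g F u(2)]]
      by (simp add: focal_chart_sgn[OF g F u(2)])
    ultimately show ?thesis by blast
  qed
  moreover have "focal_chart g p q r ` ?U \<subseteq> frontier (focal_ellipsoid g)"
    using focal_chart_frontier(1)[OF g F] b by (force simp: frontier_focal_ellipsoid[OF g])
  ultimately show ?thesis
    unfolding oriented_param_def
    by (intro conjI ballI C1_focal_chart[OF g F b] inj_focal_chart[OF g F] open_box)
qed

text \<open>
  The chart of a frame \<open>(p, q, r)\<close> misses exactly the closed half meridian through \<open>p\<close> from one
  pole to the other. In the rotated frame \<open>(r, p, q)\<close> that arc lies on the equator and stays away
  from the poles, so one further chart covers it.
\<close>

lemma cyl_direction_cover:
  assumes F: "oriented_frame p q r" and n: "norm n = 1"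
  shows "n \<in> cyl_direction p q r ` box (0, -1) (2 * pi, 1) \<or>
         n \<in> cyl_direction r p q ` ({0..pi} \<times> {0})"
proof -
  define x y w where "x = inner p n" and "y = inner q n" and "w = inner r n"
  have n_eq: "n = x *\<^sub>R p + y *\<^sub>R q + w *\<^sub>R r"
    unfolding x_def y_def w_def by (rule frame_expansion[OF F])
  have "inner n n = x\<^sup>2 + y\<^sup>2 + w\<^sup>2"
    unfolding n_eq by (simp add: inner_add_left inner_add_right frame_inner[OF F] power2_eq_square)
  then have sum: "x\<^sup>2 + y\<^sup>2 + w\<^sup>2 = 1" using n by (simp add: dot_square_norm)
  show ?thesis
  proof (cases "y = 0 \<and> x \<ge> 0")
    case True
    then have "w\<^sup>2 + x\<^sup>2 = 1" "x \<ge> 0" using sum by auto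
    then obtain t where t: "0 \<le> t" "t \<le> pi" "w = cos t" "x = sin t"
      using sincos_total_pi by metis
    then have "n = cyl_direction r p q (t, 0)"
      using n_eq True by (simp add: cyl_direction_def)
    then show ?thesis using t by auto
  next
    case False
    define s where "s = sqrt (1 - w\<^sup>2)"
    have "x\<^sup>2 + y\<^sup>2 > 0" using False by (auto simp: sum_power2_gt_zero_iff)
    then have w: "w\<^sup>2 < 1" "s > 0" "s\<^sup>2 = x\<^sup>2 + y\<^sup>2"
      using sum by (auto simp: s_def)
    have "(x / s)\<^sup>2 + (y / s)\<^sup>2 = 1"
      using w(2) by (simp add: power_divide flip: add_divide_distrib w(3))
    then obtain t where t: "0 \<le> t" "t < 2 * pi" "x / s = cos t" "y / s = sin t"
      by (rule sincos_total_2pi)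
    then have xy: "x = s * cos t" "y = s * sin t" using w(2) by (auto simp: field_simps)
    have "t \<noteq> 0" using False xy w by auto
    then have "(t, w) \<in> box (0, -1) (2 * pi, 1)"
      using t w by (auto simp: mem_box_plane abs_square_less_1)
    moreover have "n = cyl_direction p q r (t, w)"
      using n_eq by (simp add: cyl_direction_def xy s_def scaleR_add_right)
    ultimately show ?thesis by blast
  qed
qed

text \<open>
  The second piece is an arc, so only the first one contributes to integrals. The angle of the
  second chart starts at \<open>- \<pi> / 2\<close> to have \<open>[0, \<pi>]\<close> in the interior of its range.
\<close>

lemma focal_decomposition:
  assumes g: "norm g < 1" and F: "oriented_frame p q r"
  shows "boundary_decomposition (focal_ellipsoid g) 2
     (\<lambda>k. if k = 0 then box (0, -1) (2 * pi, 1) else box (- pi / 2, -1) (- pi / 2 + 2 * pi, 1))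
     (\<lambda>k. if k = 0 then focal_chart g p q r else focal_chart g r p q)
     (\<lambda>k. if k = 0 then box (0, -1) (2 * pi, 1) else {0..pi} \<times> {0})"
proof -
  note F' = frame_rotate[OF F]
  let ?B0 = "box (0, -1) (2 * pi, 1) :: (real \<times> real) set" and ?B1 = "{0..pi} \<times> {0} :: (real \<times> real) set"
  have b0: "\<bar>snd u\<bar> \<le> 1" if "u \<in> ?B0" for u using that by (auto simp: mem_box_plane)
  have b1: "\<bar>snd u\<bar> \<le> 1" if "u \<in> ?B1" for u using that by auto
  have op: "oriented_param (focal_ellipsoid g) ?B0 (focal_chart g p q r)"
    using oriented_focal_chart[OF g F, of 0] by simp
  have op': "oriented_param (focal_ellipsoid g) (box (- pi / 2, -1) (- pi / 2 + 2 * pi, 1)) (focal_chart g r p q)"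
    using oriented_focal_chart[OF g F'] .
  have sub: "?B1 \<subseteq> box (- pi / 2, -1) (- pi / 2 + 2 * pi, 1)"
  proof
    fix u :: "real \<times> real" assume "u \<in> ?B1"
    then have "0 \<le> fst u" "fst u \<le> pi" "snd u = 0" by auto
    then show "u \<in> box (- pi / 2, -1) (- pi / 2 + 2 * pi, 1)"
      unfolding mem_box_plane using pi_gt_zero by (intro conjI) linarith+
  qed
  have "closed ?B1" by (intro closed_Times) auto
  then have borel: "?B1 \<in> sets borel" by (rule borel_closed)
  have disj: "focal_chart g p q r ` ?B0 \<inter> focal_chart g r p q ` ?B1 = {}"
  proof (rule ccontr)
    assume "\<not> ?thesis"
    then obtain u v where uv: "u \<in> ?B0" "v \<in> ?B1" "focal_chart g p q r u = focal_chart g r p q v"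
      by blast
    then have eq: "cyl_direction p q r u = cyl_direction r p q v"
      using focal_chart_sgn[OF g F b0] focal_chart_sgn[OF g F' b1] by metis
    have s: "sqrt (1 - (snd u)\<^sup>2) > 0" and t: "0 < fst u" "fst u < 2 * pi"
      using uv(1) sq_less_1[of "snd u"] by (auto simp: mem_box_plane)
    have "sqrt (1 - (snd u)\<^sup>2) * sin (fst u) = snd v"
      "sqrt (1 - (snd u)\<^sup>2) * cos (fst u) = sqrt (1 - (snd v)\<^sup>2) * sin (fst v)"
      using cyl_direction_inner[OF F, of u] cyl_direction_inner[OF F', of v] eq by simp_all
    moreover have "snd v = 0" "sin (fst v) \<ge> 0" using uv(2) by (auto intro: sin_ge_zero)
    ultimately have "sqrt (1 - (snd u)\<^sup>2) * sin (fst u) = 0" "0 \<le> sqrt (1 - (snd u)\<^sup>2) * cos (fst u)"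
      by simp_all
    then have "sin (fst u) = 0" "cos (fst u) \<ge> 0"
      using s by (simp_all only: mult_eq_0_iff zero_le_mult_iff) auto
    \<comment> \<open>the coordinate along \<open>p\<close> is negative at angle \<open>\<pi>\<close>, and nonnegative on the arc\<close>
    moreover from this(1) have "fst u = pi"
      using t sin_eq_0_pi[of "fst u - pi"] by (simp add: sin_diff)
    ultimately show False by simp
  qed
  have "focal_chart g p q r ` ?B0 \<union> focal_chart g r p q ` ?B1 = frontier (focal_ellipsoid g)"
  proof
    show "focal_chart g p q r ` ?B0 \<union> focal_chart g r p q ` ?B1 \<subseteq> frontier (focal_ellipsoid g)"
      using op op' sub unfolding oriented_param_def by blast
    show "frontier (focal_ellipsoid g) \<subseteq> focal_chart g p q r ` ?B0 \<union> focal_chart g r p q ` ?B1"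
    proof
      fix y assume "y \<in> frontier (focal_ellipsoid g)"
      then have y: "norm y + inner g y = 1" by (simp add: frontier_focal_ellipsoid[OF g])
      then have y0: "y \<noteq> 0" by auto
      then have n: "norm (sgn y) = 1" by (simp add: norm_sgn)
      have "1 + inner g (sgn y) = inverse (norm y)"
        using y y0 by (simp add: sgn_div_norm field_simps)
      then have "inverse (1 + inner g (sgn y)) *\<^sub>R sgn y = y"
        using y0 by (simp add: sgn_div_norm)
      then show "y \<in> focal_chart g p q r ` ?B0 \<union> focal_chart g r p q ` ?B1"
        using cyl_direction_cover[OF F n] unfolding focal_chart_def image_iff Un_iff by metis
    qed
  qed
  then show ?thesis
    using op op' sub borel disj unfolding boundary_decomposition_def
    by (simp add: disjoint_family_on_def numeral_2_eq_2 lessThan_Suc less_Suc_eq all_conj_distrib Int_commute Un_commute)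
qed

section \<open>The boundary integral of an axially symmetric integrand\<close>

lemma linear_phi: "linear (phi a 0)"
  by (rule linearI) (simp_all add: phi_def scaleR_add_left sum.distrib scaleR_sum_right)

text \<open>
  The signs \<open>(-1)\<^sup>j\<close> are those of the cross product: the coordinates 0, 1, 2 are a cyclic
  relabelling of the components 3, 1, 2, since \<open>0 = 3\<close> in the index type. The linear maps
  \<open>phi a 0\<close> and \<open>phi b 0\<close> send \<open>y\<close> to the linear combinations of the \<open>a\<^sub>j\<close> and of the \<open>b\<^sub>j\<close> with
  coefficients \<open>y\<^sub>j\<close>.
\<close>

lemma cauchy_form_cross:
  assumes "bilinear m"
  shows "cauchy_form m a b 0 y v w = m (phi a 0 (cross3 v w)) (phi b 0 y) /\<^sub>R norm y ^ 3"
proof -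
  have 3: "(0::3) = 3" by simp
  have "dy_hat 0 v w = cross3 v w $ 3" "dy_hat 1 v w = - cross3 v w $ 1" "dy_hat 2 v w = cross3 v w $ 2"
    by (simp_all add: dy_hat_def dy_wedge_def cross_components 3)
  then have "cauchy_form m a b 0 y v w = (\<Sum>j\<in>UNIV. cross3 v w $ j *\<^sub>R m (a j) (phi b 0 y) /\<^sub>R norm y ^ 3)"
    using assms by (simp add: cauchy_form_def cauchy_coeff_def sum_3 3 mult.commute)
  then show ?thesis
    using assms by (simp add: phi_def[of a] sum_3 bilinear_ladd bilinear_lmul scaleR_add_right)
qed

lemma trig_integrals:
  "((\<lambda>t. (cos t)\<^sup>2) has_integral pi) {0..2 * pi}"
  "((\<lambda>t. (sin t)\<^sup>2) has_integral pi) {0..2 * pi}"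
  "((\<lambda>t. cos t * sin t) has_integral 0) {0..2 * pi}"
  "(cos has_integral 0) {0..2 * pi}"
  "(sin has_integral 0) {0..2 * pi}"
proof -
  have F: "(f has_integral (F (2 * pi) - F 0)) {0..2 * pi}"
    if "\<And>t. (F has_real_derivative f t) (at t)" for f F :: "real \<Rightarrow> real"
    using that by (intro fundamental_theorem_of_calculus)
      (auto simp: has_real_derivative_iff_has_vector_derivative[symmetric] intro: DERIV_subset)
  have sc: "sin t * sin t = 1 - cos t * cos t" for t :: real
    using sin_cos_squared_add[of t] by (simp add: power2_eq_square)
  have "((\<lambda>t. (cos t)\<^sup>2) has_integral (2 * pi + sin (2 * pi) * cos (2 * pi)) / 2 - (0 + sin 0 * cos 0) / 2) {0..2 * pi}"
    by (rule F) (auto intro!: derivative_eq_intros simp: power2_eq_square sc)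
  then show "((\<lambda>t. (cos t)\<^sup>2) has_integral pi) {0..2 * pi}" by simp
  have "((\<lambda>t. (sin t)\<^sup>2) has_integral (2 * pi - sin (2 * pi) * cos (2 * pi)) / 2 - (0 - sin 0 * cos 0) / 2) {0..2 * pi}"
    by (rule F) (auto intro!: derivative_eq_intros simp: power2_eq_square sc)
  then show "((\<lambda>t. (sin t)\<^sup>2) has_integral pi) {0..2 * pi}" by simp
  have "((\<lambda>t. cos t * sin t) has_integral (sin (2 * pi))\<^sup>2 / 2 - (sin 0)\<^sup>2 / 2) {0..2 * pi}"
    by (rule F) (auto intro!: derivative_eq_intros)
  then show "((\<lambda>t. cos t * sin t) has_integral 0) {0..2 * pi}" by simp
  have "(cos has_integral sin (2 * pi) - sin 0) {0..2 * pi}"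
    by (rule F) (auto intro!: derivative_eq_intros)
  then show "(cos has_integral 0) {0..2 * pi}" by simp
  have "(sin has_integral - cos (2 * pi) - - cos 0) {0..2 * pi}"
    by (rule F) (auto intro!: derivative_eq_intros)
  then show "(sin has_integral 0) {0..2 * pi}" by simp
qed

text \<open>
  In each product of coordinates with respect to the frame, mixed terms integrate to 0 over a
  circle of latitude.
\<close>

lemma latitude_integral:
  fixes Q :: "real^3 \<Rightarrow> real^3 \<Rightarrow> real^3"
  assumes Q: "bilinear Q" and w: "\<bar>w\<bar> \<le> 1"
  shows "((\<lambda>t. Q (cyl_direction p q r (t, w) + \<epsilon> *\<^sub>R r) (cyl_direction p q r (t, w))) has_integral
     (pi * (1 - w\<^sup>2)) *\<^sub>R (Q p p + Q q q) + (2 * pi * (w\<^sup>2 + \<epsilon> * w)) *\<^sub>R Q r r) {0..2 * pi}"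
proof -
  define s where "s = sqrt (1 - w\<^sup>2)"
  have s2: "s\<^sup>2 = 1 - w\<^sup>2" using w by (simp add: s_def abs_square_le_1)
  have N: "cyl_direction p q r (t, w) = s *\<^sub>R (cos t *\<^sub>R p + sin t *\<^sub>R q) + w *\<^sub>R r" for t
    by (simp add: cyl_direction_def s_def)
  let ?k = "(2 * pi) *\<^sub>R ((w\<^sup>2 + \<epsilon> * w) *\<^sub>R Q r r)"
  have const: "((\<lambda>t. (w\<^sup>2 + \<epsilon> * w) *\<^sub>R Q r r) has_integral ?k) {0..2 * pi}"
    using has_integral_const_real[of "(w\<^sup>2 + \<epsilon> * w) *\<^sub>R Q r r" 0 "2 * pi"] by simp
  note T = trig_integrals[THEN has_integral_scaleR_left]
  have "((\<lambda>t. (cos t)\<^sup>2 *\<^sub>R (s\<^sup>2 *\<^sub>R Q p p) + (sin t)\<^sup>2 *\<^sub>R (s\<^sup>2 *\<^sub>R Q q q)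
        + (cos t * sin t) *\<^sub>R (s\<^sup>2 *\<^sub>R (Q p q + Q q p))
        + cos t *\<^sub>R (s *\<^sub>R (w *\<^sub>R Q p r + (w + \<epsilon>) *\<^sub>R Q r p))
        + sin t *\<^sub>R (s *\<^sub>R (w *\<^sub>R Q q r + (w + \<epsilon>) *\<^sub>R Q r q)) + (w\<^sup>2 + \<epsilon> * w) *\<^sub>R Q r r)
      has_integral (pi *\<^sub>R (s\<^sup>2 *\<^sub>R Q p p) + pi *\<^sub>R (s\<^sup>2 *\<^sub>R Q q q)
        + 0 *\<^sub>R (s\<^sup>2 *\<^sub>R (Q p q + Q q p))
        + 0 *\<^sub>R (s *\<^sub>R (w *\<^sub>R Q p r + (w + \<epsilon>) *\<^sub>R Q r p))
        + 0 *\<^sub>R (s *\<^sub>R (w *\<^sub>R Q q r + (w + \<epsilon>) *\<^sub>R Q r q)) + ?k)) {0..2 * pi}"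
    by (intro has_integral_add T const)
  moreover have "(\<lambda>t. (cos t)\<^sup>2 *\<^sub>R (s\<^sup>2 *\<^sub>R Q p p) + (sin t)\<^sup>2 *\<^sub>R (s\<^sup>2 *\<^sub>R Q q q)
        + (cos t * sin t) *\<^sub>R (s\<^sup>2 *\<^sub>R (Q p q + Q q p))
        + cos t *\<^sub>R (s *\<^sub>R (w *\<^sub>R Q p r + (w + \<epsilon>) *\<^sub>R Q r p))
        + sin t *\<^sub>R (s *\<^sub>R (w *\<^sub>R Q q r + (w + \<epsilon>) *\<^sub>R Q r q)) + (w\<^sup>2 + \<epsilon> * w) *\<^sub>R Q r r)
     = (\<lambda>t. Q (cyl_direction p q r (t, w) + \<epsilon> *\<^sub>R r) (cyl_direction p q r (t, w)))"
    using Q unfolding N by (simp add: fun_eq_iff bilinear_ladd bilinear_radd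
        bilinear_lmul bilinear_rmul power2_eq_square algebra_simps)
  ultimately show ?thesis
    by (simp add: s2 algebra_simps)
qed

text \<open>
  For an integrand whose coefficient function depends only on the height \<open>r \<bullet> y\<close> along the axis, the
  boundary integral reduces to two weights. In \<open>h\<close>, the argument of \<open>\<tau>\<close> is the height of the
  boundary point over \<open>w\<close>, and the factor \<open>1 / (1 + \<epsilon> w)\<close> is what remains of
  \<open>|y|\<^sup>3 B y / |y|\<^sup>3\<close> after extracting \<open>B n\<close>.
\<close>

lemma boundary_identity:
  fixes m :: "real^3 \<Rightarrow> real^3 \<Rightarrow> real^3" and \<tau> :: "real \<Rightarrow> real"
  assumes m: "bilinear m" and F: "oriented_frame p q r" and \<epsilon>: "0 \<le> \<epsilon>" "\<epsilon> < 1"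
    and \<tau>: "continuous_on UNIV \<tau>"
    and int: "has_boundary_integral (\<lambda>y v w. m (\<tau> (inner r y) *\<^sub>R c) (cauchy_form m a b 0 y v w)) I
      (focal_ellipsoid (\<epsilon> *\<^sub>R r))"
  defines "Q \<equiv> \<lambda>x y. m (phi a 0 x) (phi b 0 y)" and "h \<equiv> \<lambda>w. \<tau> (w / (1 + \<epsilon> * w)) / (1 + \<epsilon> * w)"
  shows "I = (pi * integral {-1..1} (\<lambda>w. h w * (1 - w\<^sup>2))) *\<^sub>R m c (Q p p + Q q q)
     + (2 * pi * integral {-1..1} (\<lambda>w. h w * (w\<^sup>2 + \<epsilon> * w))) *\<^sub>R m c (Q r r)"
proof -
  define g where "g = \<epsilon> *\<^sub>R r"
  let ?N = "cyl_direction p q r" and ?\<sigma> = "focal_chart g p q r"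
  let ?\<omega> = "\<lambda>y v w. m (\<tau> (inner r y) *\<^sub>R c) (cauchy_form m a b 0 y v w)"
  let ?B = "box (0, -1) (2 * pi, 1) :: (real \<times> real) set" and ?C = "{0..pi} \<times> {0} :: (real \<times> real) set"
  have r: "norm r = 1" using frame_inner(3)[OF F] by (simp add: norm_eq_sqrt_inner)
  have g: "norm g < 1" using \<epsilon> r by (simp add: g_def)
  have gN: "inner g (?N u) = \<epsilon> * snd u" for u by (simp add: g_def cyl_direction_inner[OF F])
  have pos: "1 + \<epsilon> * w > 0" if "\<bar>w\<bar> \<le> 1" for w
  proof -
    have "\<bar>\<epsilon> * w\<bar> \<le> \<epsilon> * 1" using that \<epsilon>(1) unfolding abs_mult by (intro mult_mono) auto
    then show ?thesis using \<epsilon>(2) by linarith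
  qed
  have linQ: "bilinear Q"
    using m linear_phi by (auto simp: Q_def bilinear_def intro: linear_compose[unfolded o_def])
  have mQ: "bilinear (\<lambda>x y. m c (Q x y))"
    using m linQ by (auto simp: bilinear_def linear_iff)
  define G where "G u = h (snd u) *\<^sub>R m c (Q (?N u + g) (?N u))" for u

  have int': "set_integrable lborel ?B (pullback ?\<sigma> ?\<omega>)" "set_integrable lborel ?C (pullback (focal_chart g r p q) ?\<omega>)"
    and sum: "set_lebesgue_integral lborel ?B (pullback ?\<sigma> ?\<omega>)
      + set_lebesgue_integral lborel ?C (pullback (focal_chart g r p q) ?\<omega>) = I"
    using int focal_decomposition[OF g F] unfolding has_boundary_integral_def g_def[symmetric]
    by (force simp: numeral_2_eq_2)+
  \<comment> \<open>the arc is a degenerate rectangle in the parameter plane\<close>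
  have C: "?C = cbox (0, 0) (pi, 0)" by (auto simp: cbox_Pair_eq)
  have "set_lebesgue_integral lborel ?C (pullback (focal_chart g r p q) ?\<omega>) = 0"
    unfolding set_borel_integral_eq_integral(2)[OF int'(2)] unfolding C
    by (intro integral_null) (simp add: content_Pair)
  then have "I = integral ?B (pullback ?\<sigma> ?\<omega>)"
    using sum set_borel_integral_eq_integral(2)[OF int'(1)] by simp
  also have "\<dots> = integral ?B G"
  proof (rule integral_cong)
    fix u assume "u \<in> ?B"
    then have u: "\<bar>snd u\<bar> < 1" by (auto simp: mem_box_plane)
    let ?\<rho> = "inverse (1 + \<epsilon> * snd u)" and ?w = "snd u"
    have \<rho>: "?\<rho> > 0" using pos[of ?w] u by simp
    have y: "?\<sigma> u = ?\<rho> *\<^sub>R ?N u" by (simp add: focal_chart_def gN)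
    have ny: "norm (?\<sigma> u) = ?\<rho>" using focal_chart_frontier(2)[OF g F, of u] u by (simp add: gN)
    have ry: "inner r (?\<sigma> u) = ?w / (1 + \<epsilon> * ?w)"
      by (simp add: y cyl_direction_inner[OF F] divide_inverse mult.commute)
    have "pullback ?\<sigma> ?\<omega> u = m (\<tau> (?w / (1 + \<epsilon> * ?w)) *\<^sub>R c)
        (m (phi a 0 (?\<rho> ^ 3 *\<^sub>R (?N u + g))) (phi b 0 (?\<rho> *\<^sub>R ?N u)) /\<^sub>R ?\<rho> ^ 3)"
      by (simp only: pullback_def cauchy_form_cross[OF m] focal_chart_tangent[OF g F u] ry ny) (simp only: y)
    also have "\<dots> = (\<tau> (?w / (1 + \<epsilon> * ?w)) * (inverse (?\<rho> ^ 3) * (?\<rho> ^ 3 * ?\<rho>))) *\<^sub>R m c (Q (?N u + g) (?N u))"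
      using m linear_phi[of a] linear_phi[of b]
      by (simp add: Q_def bilinear_lmul bilinear_rmul linear_scale del: power_inverse)
    also have "inverse (?\<rho> ^ 3) * (?\<rho> ^ 3 * ?\<rho>) = ?\<rho>" using \<rho> by simp
    finally show "pullback ?\<sigma> ?\<omega> u = G u" by (simp add: G_def h_def divide_inverse)
  qed
  also have "\<dots> = integral (cbox (0, -1) (2 * pi, 1)) G" by (rule integral_open_interval)
  also have "\<dots> = integral (cbox (-1) 1) (\<lambda>w. integral (cbox 0 (2 * pi)) (\<lambda>t. G (t, w)))"
  proof -
    let ?S = "cbox (0, -1) (2 * pi, 1) :: (real \<times> real) set"
    have b: "\<bar>snd u\<bar> \<le> 1" if "u \<in> ?S" for u using that by (cases u) (auto simp: cbox_Pair_eq)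
    have ne: "1 + \<epsilon> * snd u \<noteq> 0" if "u \<in> ?S" for u using pos[OF b[OF that]] by simp
    have N: "continuous_on ?S ?N" unfolding cyl_direction_def by (intro continuous_intros)
    have "bounded_bilinear (\<lambda>x y. m c (Q x y))" using mQ by (simp add: bilinear_conv_bounded_bilinear)
    from bounded_bilinear.continuous_on[OF this]
    have mQN: "continuous_on ?S (\<lambda>u. m c (Q (?N u + g) (?N u)))"
      by this (intro continuous_intros N)+
    have "continuous_on ?S (\<lambda>u. \<tau> (snd u / (1 + \<epsilon> * snd u)))"
      by (rule continuous_on_compose2[OF \<tau>]) (auto intro!: continuous_intros ne)
    then have G: "continuous_on ?S G"
      unfolding G_def h_def by (intro continuous_intros mQN ballI ne)
    then have "integral ?S G = integral (cbox 0 (2 * pi)) (\<lambda>t. integral (cbox (-1) 1) (\<lambda>w. G (t, w)))"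
      by (rule integral_prod_continuous)
    also have "\<dots> = integral (cbox (-1) 1) (\<lambda>w. integral (cbox 0 (2 * pi)) (\<lambda>t. G (t, w)))"
      using G by (intro integral_swap_continuous) simp
    finally show ?thesis .
  qed
  also have "\<dots> = integral {-1..1} (\<lambda>w. (h w * (1 - w\<^sup>2)) *\<^sub>R pi *\<^sub>R m c (Q p p + Q q q)
      + (h w * (w\<^sup>2 + \<epsilon> * w)) *\<^sub>R (2 * pi) *\<^sub>R m c (Q r r))"
    unfolding box_real
  proof (rule integral_cong)
    fix w :: real assume "w \<in> {-1..1}"
    then have "\<bar>w\<bar> \<le> 1" by auto
    from latitude_integral[OF mQ this, of p q r \<epsilon>]
    have "integral {0..2 * pi} (\<lambda>t. G (t, w)) = h w *\<^sub>R ((pi * (1 - w\<^sup>2)) *\<^sub>R (m c (Q p p) + m c (Q q q))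
        + (2 * pi * (w\<^sup>2 + \<epsilon> * w)) *\<^sub>R m c (Q r r))"
      unfolding G_def g_def[symmetric] by (simp add: integral_unique)
    also have "m c (Q p p) + m c (Q q q) = m c (Q p p + Q q q)" using m by (simp add: bilinear_radd)
    finally show "integral {0..2 * pi} (\<lambda>t. G (t, w)) = (h w * (1 - w\<^sup>2)) *\<^sub>R pi *\<^sub>R m c (Q p p + Q q q)
      + (h w * (w\<^sup>2 + \<epsilon> * w)) *\<^sub>R (2 * pi) *\<^sub>R m c (Q r r)"
      by (simp add: scaleR_add_right mult_ac)
  qed
  also have "\<dots> = integral {-1..1} (\<lambda>w. h w * (1 - w\<^sup>2)) *\<^sub>R pi *\<^sub>R m c (Q p p + Q q q)
      + integral {-1..1} (\<lambda>w. h w * (w\<^sup>2 + \<epsilon> * w)) *\<^sub>R (2 * pi) *\<^sub>R m c (Q r r)"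
  proof -
    have ne: "1 + \<epsilon> * w \<noteq> 0" if "w \<in> {-1..1}" for w using pos[of w] that by (auto simp: abs_le_iff)
    have "continuous_on {-1..1} (\<lambda>w. \<tau> (w / (1 + \<epsilon> * w)))"
      by (rule continuous_on_compose2[OF \<tau>]) (auto intro!: continuous_intros ne)
    then have h: "continuous_on {-1..1} h"
      unfolding h_def by (intro continuous_intros ballI ne)
    have "(\<lambda>w. h w * (1 - w\<^sup>2)) integrable_on {-1..1}" "(\<lambda>w. h w * (w\<^sup>2 + \<epsilon> * w)) integrable_on {-1..1}"
      by (intro integrable_continuous_real continuous_intros h)+
    then show ?thesis
      by (intro integral_unique has_integral_add has_integral_scaleR_left integrable_integral)
  qed
  finally show ?thesis by (simp add: mult.commute)
qed

section \<open>Consequences of the Cauchy formula\<close>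

lemma polynomial_integral:
  fixes f F :: "real \<Rightarrow> real"
  assumes "\<And>w. (F has_real_derivative f w) (at w)"
  shows "(f has_integral (F 1 - F (-1))) {-1..1}"
  using assms by (intro fundamental_theorem_of_calculus)
    (auto simp: has_real_derivative_iff_has_vector_derivative[symmetric] intro: DERIV_subset)

lemma round_integrals:
  "integral {-1..1} (\<lambda>w. 1 - w\<^sup>2) = (4 / 3 :: real)" "integral {-1..1} (\<lambda>w. w\<^sup>2) = (2 / 3 :: real)"
proof -
  have "((\<lambda>w. 1 - w\<^sup>2) has_integral ((1 - 1 ^ 3 / 3) - ((-1) - (-1) ^ 3 / 3 :: real))) {-1..1}"
    by (rule polynomial_integral) (auto intro!: derivative_eq_intros)
  then show "integral {-1..1} (\<lambda>w. 1 - w\<^sup>2) = (4 / 3 :: real)" by (simp add: integral_unique)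
  have "((\<lambda>w. w\<^sup>2) has_integral (1 ^ 3 / 3 - (-1) ^ 3 / 3 :: real)) {-1..1}"
    by (rule polynomial_integral) (auto intro!: derivative_eq_intros)
  then show "integral {-1..1} (\<lambda>w. w\<^sup>2) = (2 / 3 :: real)" by (simp add: integral_unique)
qed

text \<open>
  By the value \<open>4 / 3\<close> in \<open>round_integrals\<close>, the strict inequality says that an ellipsoid distinguishes
  its axis. It follows from \<open>1 / (1 + w / 2) \<ge> 1 - w / 2 + w\<^sup>2 / 6\<close>, whose odd part integrates to 0
  against \<open>1 - w\<^sup>2\<close>.
\<close>

lemma focal_weights_const:
  defines "h \<equiv> \<lambda>w::real. 1 / (1 + 1 / 2 * w)"
  shows "integral {-1..1} (\<lambda>w. h w * (1 - w\<^sup>2)) + integral {-1..1} (\<lambda>w. h w * (w\<^sup>2 + 1 / 2 * w)) = 2" (is "?A + ?B = 2")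
    and "integral {-1..1} (\<lambda>w. h w * (1 - w\<^sup>2)) > 4 / 3"
proof -
  have pos: "1 + 1 / 2 * w > 0" if "w \<in> {-1..1}" for w :: real using that by auto
  have h: "continuous_on {-1..1} h" unfolding h_def using pos by (intro continuous_intros ballI) force
  have int: "(\<lambda>w. h w * (1 - w\<^sup>2)) integrable_on {-1..1}" "(\<lambda>w. h w * (w\<^sup>2 + 1 / 2 * w)) integrable_on {-1..1}"
    by (intro integrable_continuous_real continuous_intros h)+
  have "?A + ?B = integral {-1..1} (\<lambda>w. h w * (1 - w\<^sup>2) + h w * (w\<^sup>2 + 1 / 2 * w))"
    using int by (simp add: integral_add)
  also have "\<dots> = integral {-1..1} (\<lambda>w::real. 1 :: real)"
  proof (rule integral_cong)
    fix w :: real assume "w \<in> {-1..1}"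
    then have "h w * (1 + 1 / 2 * w) = 1" using pos[of w] by (simp add: h_def)
    then show "h w * (1 - w\<^sup>2) + h w * (w\<^sup>2 + 1 / 2 * w) = 1" by (simp add: algebra_simps)
  qed
  finally show "?A + ?B = 2" by simp
  have "((\<lambda>w. (1 - w\<^sup>2) * (1 - w / 2 + w\<^sup>2 / 6)) has_integral
      ((1 - 1\<^sup>2 / 4 - 5 * 1 ^ 3 / 18 + 1 ^ 4 / 8 - 1 ^ 5 / 30) -
       ((-1) - (-1)\<^sup>2 / 4 - 5 * (-1) ^ 3 / 18 + (-1) ^ 4 / 8 - (-1) ^ 5 / 30) :: real)) {-1..1}"
    by (rule polynomial_integral)
       (auto intro!: derivative_eq_intros simp: power2_eq_square power3_eq_cube power4_eq_xxxx field_simps)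
  moreover have "(1 - w\<^sup>2) * (1 - w / 2 + w\<^sup>2 / 6) \<le> h w * (1 - w\<^sup>2)" if w: "w \<in> {-1..1}" for w
  proof -
    have "(1 - w / 2 + w\<^sup>2 / 6) * (1 + 1 / 2 * w) = 1 - w\<^sup>2 * (1 - w) / 12"
      by (simp add: power2_eq_square field_simps)
    also have "\<dots> \<le> 1" using w by simp
    finally have "1 - w / 2 + w\<^sup>2 / 6 \<le> h w" using pos[OF w] by (simp only: h_def pos_le_divide_eq)
    moreover have "1 - w\<^sup>2 \<ge> 0" using w by (simp add: abs_square_le_1 abs_le_iff)
    ultimately show ?thesis by (subst (2) mult.commute) (rule mult_left_mono)
  qed
  ultimately have "4 / 3 + 2 / 45 \<le> ?A"
    by (intro has_integral_le[OF _ integrable_integral[OF int(1)]]) auto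
  then show "?A > 4 / 3" by simp
qed

text \<open>
  The two integrands add up to \<open>w / (1 + w / 2)\<close>, which is at most \<open>w - w\<^sup>2 / 3\<close>.
\<close>

lemma focal_weights_linear:
  defines "h \<equiv> \<lambda>w::real. w / (1 + 1 / 2 * w) / (1 + 1 / 2 * w)"
  shows "integral {-1..1} (\<lambda>w. h w * (1 - w\<^sup>2)) + integral {-1..1} (\<lambda>w. h w * (w\<^sup>2 + 1 / 2 * w)) < 0" (is "?A + ?B < 0")
proof -
  have pos: "1 + 1 / 2 * w > 0" if "w \<in> {-1..1}" for w :: real using that by auto
  have h: "continuous_on {-1..1} h" unfolding h_def using pos by (intro continuous_intros ballI) force+
  have int: "(\<lambda>w. h w * (1 - w\<^sup>2)) integrable_on {-1..1}" "(\<lambda>w. h w * (w\<^sup>2 + 1 / 2 * w)) integrable_on {-1..1}"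
    by (intro integrable_continuous_real continuous_intros h)+
  have "((\<lambda>w. w - w\<^sup>2 / 3) has_integral
      ((1\<^sup>2 / 2 - 1 ^ 3 / 9) - ((-1)\<^sup>2 / 2 - (-1) ^ 3 / 9) :: real)) {-1..1}"
    by (rule polynomial_integral) (auto intro!: derivative_eq_intros)
  moreover have "h w * (1 - w\<^sup>2) + h w * (w\<^sup>2 + 1 / 2 * w) \<le> w - w\<^sup>2 / 3" if w: "w \<in> {-1..1}" for w
  proof -
    have "h w * (1 - w\<^sup>2) + h w * (w\<^sup>2 + 1 / 2 * w) = h w * (1 + 1 / 2 * w)" by (simp add: algebra_simps)
    also have "\<dots> = w / (1 + 1 / 2 * w)" using pos[OF w] by (simp add: h_def)
    also have "\<dots> \<le> w - w\<^sup>2 / 3"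
    proof -
      have "(w - w\<^sup>2 / 3) * (1 + 1 / 2 * w) = w + w\<^sup>2 * (1 - w) / 6"
        by (simp add: power2_eq_square field_simps)
      also have "\<dots> \<ge> w" using w by simp
      finally show ?thesis using pos[OF w] by (simp only: pos_divide_le_eq)
    qed
    finally show ?thesis .
  qed
  ultimately have "?A + ?B \<le> - 2 / 9"
    by (intro has_integral_le[OF has_integral_add[OF int[THEN integrable_integral]]]) auto
  then show ?thesis by simp
qed

definition reproduces ::
  "(real^3 \<Rightarrow> real^3 \<Rightarrow> real^3) \<Rightarrow> (3 \<Rightarrow> real^3) \<Rightarrow> (3 \<Rightarrow> real^3) \<Rightarrow> bool" where
  "reproduces m a b \<longleftrightarrow>
     (\<forall>D f. smooth_bounded_domain D \<longrightarrow> C1_on (closure D) f \<longrightarrow> cauchy_condition m a D f \<longrightarrow>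
        (\<forall>x\<in>D. has_boundary_integral (\<lambda>y v w. m (f y) (cauchy_form m a b x y v w)) (f x) D))"

text \<open>
  The test functions are \<open>(k0 + k1 (r \<bullet> y)) c\<close>; hypothesis \<open>c\<close> is the Cauchy condition for them.
\<close>

lemma affine_formula:
  fixes k0 k1 :: real
  assumes m: "bilinear m" and F: "oriented_frame p q r" and \<epsilon>: "0 \<le> \<epsilon>" "\<epsilon> < 1"
    and formula: "reproduces m a b"
    and c: "k1 *\<^sub>R m (phi a 0 r) c = 0"
  defines "Q \<equiv> \<lambda>x y. m (phi a 0 x) (phi b 0 y)"
    and "h \<equiv> \<lambda>w. (k0 + k1 * (w / (1 + \<epsilon> * w))) / (1 + \<epsilon> * w)"
  shows "k0 *\<^sub>R c = (pi * integral {-1..1} (\<lambda>w. h w * (1 - w\<^sup>2))) *\<^sub>R m c (Q p p + Q q q)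
     + (2 * pi * integral {-1..1} (\<lambda>w. h w * (w\<^sup>2 + \<epsilon> * w))) *\<^sub>R m c (Q r r)"
proof -
  let ?f = "\<lambda>y. (k0 + k1 * inner r y) *\<^sub>R c" and ?D = "focal_ellipsoid (\<epsilon> *\<^sub>R r)"
  have r: "norm r = 1" using frame_inner(3)[OF F] by (simp add: norm_eq_sqrt_inner)
  have g: "norm (\<epsilon> *\<^sub>R r) < 1" using \<epsilon> r by simp
  have der: "(?f has_derivative (\<lambda>h. (k1 * inner r h) *\<^sub>R c)) (at x within S)" for x S
    by (auto intro!: derivative_eq_intros)
  have "bounded_linear (\<lambda>h. (k1 * inner r h) *\<^sub>R c)"
    using has_derivative_bounded_linear[OF der] .
  then have "C1_on (closure ?D) ?f"
    unfolding C1_on_def using der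
    by (intro exI[of _ "\<lambda>_. Blinfun (\<lambda>h. (k1 * inner r h) *\<^sub>R c)"]) (auto simp: bounded_linear_Blinfun_apply)
  moreover have "cauchy_condition m a ?D ?f"
    unfolding cauchy_condition_def
  proof
    fix x
    have "(\<Sum>j\<in>UNIV. m (a j) (partial j ?f x)) = (\<Sum>j\<in>UNIV. (k1 * r $ j) *\<^sub>R m (a j) c)"
      using m by (simp only: partial_eq[OF der] bilinear_rmul) (simp add: inner_axis)
    also have "\<dots> = k1 *\<^sub>R m (phi a 0 r) c"
      using m by (simp add: phi_def sum_3 bilinear_ladd bilinear_lmul scaleR_add_right)
    finally show "(\<Sum>j\<in>UNIV. m (a j) (partial j ?f x)) = 0" using c by simp
  qed
  moreover have "0 \<in> ?D" by (simp add: focal_ellipsoid_def)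
  ultimately have "has_boundary_integral (\<lambda>y v w. m (?f y) (cauchy_form m a b 0 y v w)) (?f 0) ?D"
    using formula smooth_focal_ellipsoid[OF g] unfolding reproduces_def by blast
  from boundary_identity[OF m F \<epsilon> _ this] show ?thesis
    unfolding Q_def h_def by (simp add: continuous_intros)
qed

text \<open>
  The constant function \<open>E\<close> on the ball and on the ellipsoid with \<open>\<epsilon> = 1/2\<close> gives two linear
  equations for \<open>P\<close> and \<open>R\<close>. Eliminating \<open>P\<close> determines \<open>R\<close> as soon as the weight \<open>A\<close> differs from
  its value \<open>4 / 3\<close> on the ball.
\<close>

lemma unit_products:
  assumes m: "bilinear m" and unit: "\<And>x. m E x = x" "\<And>x. m x E = x" and r: "norm r = 1"
    and formula: "reproduces m a b"
  shows "m (phi a 0 r) (phi b 0 r) = (1 / (4 * pi)) *\<^sub>R E"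
proof -
  obtain p q where F: "oriented_frame p q r" using frame_exists[OF r] .
  define P where "P = m (phi a 0 p) (phi b 0 p) + m (phi a 0 q) (phi b 0 q)"
  define R where "R = m (phi a 0 r) (phi b 0 r)"
  define A where "A = integral {-1..1} (\<lambda>w::real. 1 / (1 + 1 / 2 * w) * (1 - w\<^sup>2))"
  have A: "A > 4 / 3" and B: "integral {-1..1} (\<lambda>w::real. 1 / (1 + 1 / 2 * w) * (w\<^sup>2 + 1 / 2 * w)) = 2 - A"
    using focal_weights_const unfolding A_def by linarith+
  have c: "0 *\<^sub>R m (phi a 0 r) E = 0" by simp
  have 1: "E = (pi * (4 / 3)) *\<^sub>R P + (2 * pi * (2 / 3)) *\<^sub>R R"
    using affine_formula[OF m F _ _ formula c, of 0 1]
    by (simp add: unit round_integrals P_def R_def)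
  have "E = (pi * A) *\<^sub>R P + (2 * pi * (2 - A)) *\<^sub>R R"
    using affine_formula[OF m F _ _ formula c, of "1 / 2" 1] B
    by (simp add: unit P_def R_def A_def)
  then have "(4 / 3) *\<^sub>R E = (4 / 3 * (pi * A)) *\<^sub>R P + (4 / 3 * (2 * pi * (2 - A))) *\<^sub>R R"
    by (simp add: scaleR_add_right)
  moreover have "A *\<^sub>R E = (4 / 3 * (pi * A)) *\<^sub>R P + (A * (2 * pi * (2 / 3))) *\<^sub>R R"
    using arg_cong[OF 1, of "\<lambda>x. A *\<^sub>R x"]
    by (simp only: scaleR_add_right scaleR_scaleR mult_ac)
  ultimately have "(4 / 3) *\<^sub>R E - A *\<^sub>R E = (4 / 3 * (2 * pi * (2 - A))) *\<^sub>R R - (A * (2 * pi * (2 / 3))) *\<^sub>R R"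
    by simp
  then have "(4 / 3 - A) *\<^sub>R E = (4 / 3 * (2 * pi * (2 - A)) - A * (2 * pi * (2 / 3))) *\<^sub>R R"
    by (simp only: scaleR_left_diff_distrib)
  also have "4 / 3 * (2 * pi * (2 - A)) - A * (2 * pi * (2 / 3)) = (4 / 3 - A) * (4 * pi)"
    by (simp add: algebra_simps)
  finally have "(4 / 3 - A) *\<^sub>R E = (4 / 3 - A) *\<^sub>R (4 * pi) *\<^sub>R R" by simp
  then have "E = (4 * pi) *\<^sub>R R" using A by (subst (asm) scaleR_cancel_left) auto
  then show ?thesis by (simp add: R_def)
qed

text \<open>
  The map \<open>A\<close> is bijective, so \<open>A z = E\<close> for some \<open>z\<close>. Polarizing with \<open>z\<close> shows that \<open>B\<close> is a
  negative multiple of \<open>A\<close> on the plane orthogonal to \<open>z\<close>. Commutativity then turns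
  \<open>A p B q + A q B p = 0\<close> into \<open>A p A q = 0\<close> for orthonormal \<open>p\<close>, \<open>q\<close> in that plane, and the function
  \<open>(p \<bullet> y) A q\<close> violates the formula.
\<close>

lemma commutative_contradiction:
  assumes m: "bilinear m" and unit: "\<And>x. m E x = x" "\<And>x. m x E = x" and E: "E \<noteq> 0"
    and comm: "\<And>x y. m x y = m y x"
    and formula: "reproduces m a b"
  shows False
proof -
  define A where "A = phi a 0"
  define B where "B = phi b 0"
  define \<mu> where "\<mu> = 1 / (4 * pi)"
  have \<mu>: "\<mu> > 0" by (simp add: \<mu>_def)
  have lin: "linear A" "linear B" by (simp_all add: A_def B_def linear_phi)
  have q: "m (A v) (B v) = \<mu> *\<^sub>R E" if "norm v = 1" for v
    using unit_products[OF m unit that formula] by (simp add: A_def B_def \<mu>_def)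
  have "bilinear (\<lambda>v w. m (A v) (B w))"
    using m lin by (auto simp: bilinear_def intro: linear_compose[unfolded o_def])
  from square_form_polarized[OF this q]
  have pol: "m (A v) (B w) + m (A w) (B v) = (2 * inner v w) *\<^sub>R \<mu> *\<^sub>R E" for v w .
  have A0: "v = 0" if "A v = 0" for v
    using pol[of v v] that m E \<mu> by (simp add: bilinear_lzero)
  then have "inj A" using lin(1) by (simp add: linear_injective_0)
  then have "surj A" using lin(1) by (simp add: linear_injective_imp_surjective)
  then obtain z where z: "A z = E" by (metis surjD)
  then have z0: "z \<noteq> 0" using E lin(1) by (auto simp: linear_0)
  then have nz: "norm (sgn z) = 1" by (simp add: norm_sgn)
  then obtain p q where F: "oriented_frame p q (sgn z)" by (rule frame_exists)
  have perp: "inner z p = 0" "inner z q = 0"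
    using frame_inner(7,9)[OF F] z0 by (auto simp: sgn_div_norm)
  have "2 *\<^sub>R B z = (2 * inner z z) *\<^sub>R \<mu> *\<^sub>R E"
    using pol[of z z] by (simp add: z unit scaleR_2)
  then have "2 *\<^sub>R B z = 2 *\<^sub>R ((inner z z * \<mu>) *\<^sub>R E)" by simp
  then have Bz: "B z = (inner z z * \<mu>) *\<^sub>R E" by (subst (asm) scaleR_cancel_left) simp
  have B_perp: "B v = - (inner z z * \<mu>) *\<^sub>R A v" if "inner z v = 0" for v
    using pol[of z v] that m by (simp add: z unit Bz bilinear_rmul add_eq_0_iff)
  have "2 *\<^sub>R ((- (inner z z * \<mu>)) *\<^sub>R m (A p) (A q)) = (2 * inner p q) *\<^sub>R \<mu> *\<^sub>R E"
    using pol[of p q] m comm[of "A q" "A p"]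
    by (simp only: B_perp[OF perp(1)] B_perp[OF perp(2)] bilinear_rmul scaleR_2)
  then have "2 *\<^sub>R ((- (inner z z * \<mu>)) *\<^sub>R m (A p) (A q)) = 0"
    using frame_inner(4)[OF F] by simp
  then have "m (A p) (A q) = 0" using z0 \<mu> by simp
  then have c: "1 *\<^sub>R m (phi a 0 p) (A q) = 0" by (simp add: A_def)
  have F': "oriented_frame q (sgn z) p" using frame_rotate[OF frame_rotate[OF F]] .
  define \<alpha> where "\<alpha> = integral {-1..1} (\<lambda>w::real. w / (1 + 1 / 2 * w) / (1 + 1 / 2 * w) * (1 - w\<^sup>2))"
  define \<beta> where "\<beta> = integral {-1..1} (\<lambda>w::real. w / (1 + 1 / 2 * w) / (1 + 1 / 2 * w) * (w\<^sup>2 + 1 / 2 * w))"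
  have neg: "\<alpha> + \<beta> < 0" unfolding \<alpha>_def \<beta>_def by (rule focal_weights_linear)
  have n: "norm p = 1" "norm q = 1" "norm (sgn z) = 1"
    using F nz by (simp_all add: oriented_frame_def)
  have "0 = (pi * \<alpha>) *\<^sub>R m (A q) (m (A q) (B q) + m (A (sgn z)) (B (sgn z))) + (2 * pi * \<beta>) *\<^sub>R m (A q) (m (A p) (B p))"
    using affine_formula[OF m F' _ _ formula c, of "1 / 2" 0] by (simp add: \<alpha>_def \<beta>_def A_def B_def)
  also have "m (A q) (B q) + m (A (sgn z)) (B (sgn z)) = (2 * \<mu>) *\<^sub>R E"
    by (simp only: q n scaleR_2[symmetric] scaleR_scaleR)
  also have "(pi * \<alpha>) *\<^sub>R m (A q) ((2 * \<mu>) *\<^sub>R E) + (2 * pi * \<beta>) *\<^sub>R m (A q) (m (A p) (B p))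
      = (2 * pi * \<mu> * (\<alpha> + \<beta>)) *\<^sub>R A q"
    using m by (simp add: q n bilinear_rmul unit algebra_simps)
  finally have "A q = 0" using neg \<mu> by simp
  then have "q = 0" by (rule A0)
  then show False using n by simp
qed

theorem mainTheorem7:
  fixes mul :: "'a::real_vector \<Rightarrow> 'a \<Rightarrow> 'a" and one :: 'a
  assumes "unital_algebra mul one" and "dim (UNIV :: 'a set) = 3"
  shows "((\<forall>x y z. mul (mul x y) z = mul x (mul y z)) \<longrightarrow>
            \<not> (\<exists>e a. unital_basis one e \<and> admits_cauchy_formula (coord_mult e mul) a)) \<and>
         ((\<forall>x y. mul x y = mul y x) \<longrightarrow>
            \<not> (\<exists>e a. unital_basis one e \<and> admits_cauchy_formula (coord_mult e mul) a))"
proof -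
  define E :: "real^3" where "E = axis 0 1"
  have E: "E \<noteq> 0" by (simp add: E_def axis_eq_0_iff)
  {
    fix e :: "3 \<Rightarrow> 'a" and a
    assume e: "unital_basis one e" and adm: "admits_cauchy_formula (coord_mult e mul) a"
    let ?m = "coord_mult e mul"
    note m = coord_mult_bilinear[OF assms(1) e]
    have unit: "?m E x = x" "?m x E = x" for x
      unfolding E_def by (rule coord_mult_unit[OF assms(1) e])+
    from adm obtain b where formula: "reproduces ?m a b"
      unfolding admits_cauchy_formula_def reproduces_def by blast
    have "\<not> (\<forall>x y z. mul (mul x y) z = mul x (mul y z))"
    proof
      assume assoc: "\<forall>x y z. mul (mul x y) z = mul x (mul y z)"
      have assoc': "?m (?m x y) z = ?m x (?m y z)" for x y z
        using assoc by (simp add: coord_mult_def from_to_coords[OF e])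
      show False
        by (rule associative_contradiction[OF m unit(1) assoc' linear_phi linear_phi
              unit_products[OF m unit _ formula]]) simp_all
    qed
    moreover have "\<not> (\<forall>x y. mul x y = mul y x)"
    proof
      assume "\<forall>x y. mul x y = mul y x"
      then have comm: "?m x y = ?m y x" for x y by (simp add: coord_mult_def)
      show False by (rule commutative_contradiction[OF m unit E comm formula])
    qed
    ultimately have "\<not> (\<forall>x y z. mul (mul x y) z = mul x (mul y z)) \<and> \<not> (\<forall>x y. mul x y = mul y x)" ..
  }
  then show ?thesis by metis
qed

end
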